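(* Let $A$ be a two-dimensional AS regular algebra which is not commutative; up to isomorphism $A$ is either $\Bbbk_q[u,v]$ with $q\in\Bbbk^\times$, $q\neq 1$, or $\Bbbk_J[u,v]$. Let $G$ be a nontrivial small subgroup of $\mathrm{Aut}_{\mathrm{gr}}(A)$. Then, up to conjugation of $G$ by an element of $\mathrm{Aut}_{\mathrm{gr}}(A)$, exactly one of the following holds: (i) $A=\Bbbk_q[u,v]$ with $q\neq 1$ and $G=\frac1n(1,a)$, the cyclic group generated by $\begin{pmatrix}\omega_n&0\\0&\omega_n^a\end{pmatrix}$, where $1\le a<n$ and $\gcd(a,n)=1$; (ii) $A=\Bbbk_{-1}[u,v]$ and $G=G_{n,k}$ with $\gcd(n,k)=1$ and $k\not\equiv 2 \pmod 4$; (iii) $A=\Bbbk_J[u,v]$ and $G=\frac1n(1,1)$, the cyclic group generated by $\begin{pmatrix}\omega_n&0\\0&\omega_n\end{pmatrix}$, with $n\ge 2$. Conversely, every group listed (acting on the listed algebra) is a small subgroup of $\mathrm{Aut}_{\mathrm{gr}}(A)$.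
   Context: $\Bbbk$ is an algebraically closed field of characteristic $0$, and $\omega_n$ denotes a primitive $n$th root of unity. $\Bbbk_q[u,v]=\Bbbk\langle u,v\rangle/(vu-quv)$ ($q\in\Bbbk^\times$) and $\Bbbk_J[u,v]=\Bbbk\langle u,v\rangle/(vu-uv-u^2)$, graded with $\deg u=\deg v=1$; both have Hilbert series $(1-t)^{-2}$. A matrix $g=\begin{pmatrix}a&b\\c&d\end{pmatrix}\in \mathrm{GL}(2,\Bbbk)$ acts (when it defines a graded automorphism) by $g\cdot u=au+cv$, $g\cdot v=bu+dv$; in this way $\mathrm{Aut}_{\mathrm{gr}}(A)$ is identified with a subgroup of $\mathrm{GL}(2,\Bbbk)$. For a graded automorphism $g$ of $A$, its trace is $\mathrm{Tr}_A(g)=\sum_{i\ge0}\mathrm{tr}(g|_{A_i})\,t^i$. Such $g$ is a quasi-reflection if $\mathrm{Tr}_A(g)=\frac{1}{(1-t)p(t)}$ with $p(1)\neq0$ (equivalently here, $\mathrm{Tr}_A(g)=\frac{1}{(1-t)(1-\lambda t)}$ for some $\lambda\ne1$). A finite subgroup of $\mathrm{Aut}_{\mathrm{gr}}(A)$ is small if it contains no quasi-reflections. For positive integers $n,k$, let $\omega$ be a primitive $(2nk)$th root of unity and $G_{n,k}=\left\langle \begin{pmatrix}\omega^{2k}&0\\0&\omega^{-2k}\end{pmatrix},\begin{pmatrix}0&\omega^{n}\\\omega^{n}&0\end{pmatrix}\right\rangle\le \mathrm{Aut}_{\mathrm{gr}}(\Bbbk_{-1}[u,v])$ (so the generators are $\mathrm{diag}(\omega_n,\omega_n^{-1})$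 and the antidiagonal matrix with both entries a primitive $2k$th root of unity). *)

theory Defs
  imports "HOL-Analysis.Analysis" "HOL-Computational_Algebra.Polynomial_FPS"
begin

text \<open>Generators: False stands for u, True stands for v.  Degree-i elements of the
free algebra are functions on words (bool lists) supported on words of length i.\<close>

datatype 'a alg = Qalg 'a | Jalg

fun rel :: "'a::comm_ring_1 alg \<Rightarrow> bool list \<Rightarrow> 'a" where
  "rel (Qalg q) = (\<lambda>w. if w = [True, False] then 1 else if w = [False, True] then - q else 0)"
| "rel Jalg = (\<lambda>w. if w = [True, False] then 1 else if w = [False, True] then -1
                    else if w = [False, False] then -1 else 0)"

definition mat2 :: "'a::zero \<Rightarrow> 'a \<Rightarrow> 'a \<Rightarrow> 'a \<Rightarrow> 'a^2^2" where
  "mat2 a b c d = (\<chi> i j. if i = 1 then (if j = 1 then a else b) else (if j = 1 then c else d))"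

definition idx :: "bool \<Rightarrow> 2" where "idx b = (if b then 2 else 1)"

text \<open>Coefficient of generator y in g(x): the matrix (a b; c d) sends u to au+cv and v to bu+dv.\<close>
definition gc :: "'a::semiring_1^2^2 \<Rightarrow> bool \<Rightarrow> bool \<Rightarrow> 'a" where
  "gc g x y = g $ idx y $ idx x"

definition words :: "nat \<Rightarrow> bool list set" where "words i = {w. length w = i}"

definition tens :: "nat \<Rightarrow> (bool list \<Rightarrow> 'a::zero) set" where
  "tens i = {f. \<forall>w. length w \<noteq> i \<longrightarrow> f w = 0}"

definition act :: "'a::comm_ring_1^2^2 \<Rightarrow> nat \<Rightarrow> (bool list \<Rightarrow> 'a) \<Rightarrow> (bool list \<Rightarrow> 'a)" where
  "act g i f = (\<lambda>w'. if length w' = i then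
       (\<Sum>w\<in>words i. f w * (\<Prod>j<i. gc g (w ! j) (w' ! j))) else 0)"

definition lincomb :: "(bool list \<Rightarrow> 'a::comm_ring_1) list \<Rightarrow> (nat \<Rightarrow> 'a) \<Rightarrow> (bool list \<Rightarrow> 'a)" where
  "lincomb B c = (\<lambda>x. \<Sum>j<length B. c j * (B ! j) x)"

definition embed :: "bool list \<Rightarrow> (bool list \<Rightarrow> 'a::zero) \<Rightarrow> bool list \<Rightarrow> (bool list \<Rightarrow> 'a)" where
  "embed w1 r w2 = (\<lambda>w. if length w = length w1 + 2 + length w2 \<and> take (length w1) w = w1
                           \<and> drop (length w1 + 2) w = w2
                        then r (take 2 (drop (length w1) w)) else 0)"

definition ideal_deg :: "'a::comm_ring_1 alg \<Rightarrow> nat \<Rightarrow> (bool list \<Rightarrow> 'a) set" where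
  "ideal_deg A i = {lincomb B c | B c. set B \<subseteq>
       {embed w1 (rel A) w2 | w1 w2. length w1 + length w2 + 2 = i}}"

text \<open>Trace of the map induced by T on the quotient space W / I (computed in a basis of W/I,
  represented by elements of W).\<close>
definition trace_quot :: "(bool list \<Rightarrow> 'a::comm_ring_1) set \<Rightarrow> (bool list \<Rightarrow> 'a) set
     \<Rightarrow> ((bool list \<Rightarrow> 'a) \<Rightarrow> (bool list \<Rightarrow> 'a)) \<Rightarrow> 'a" where
  "trace_quot W I T = (SOME t. \<exists>B C. set B \<subseteq> W
      \<and> (\<forall>c. lincomb B c \<in> I \<longrightarrow> (\<forall>j<length B. c j = 0))
      \<and> (\<forall>w\<in>W. \<exists>c. w - lincomb B c \<in> I)
      \<and> (\<forall>j<length B. T (B ! j) - lincomb B (\<lambda>l. C l j) \<in> I)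
      \<and> t = (\<Sum>j<length B. C j j))"

definition is_gr_aut :: "'a::field alg \<Rightarrow> 'a^2^2 \<Rightarrow> bool" where
  "is_gr_aut A g = (det g \<noteq> 0 \<and> (\<exists>c. act g 2 (rel A) = (\<lambda>w. c * rel A w)))"

definition Aut :: "'a::field alg \<Rightarrow> ('a^2^2) set" where
  "Aut A = {g. is_gr_aut A g}"

definition Tr :: "'a::field alg \<Rightarrow> 'a^2^2 \<Rightarrow> 'a fps" where
  "Tr A g = Abs_fps (\<lambda>i. trace_quot (tens i) (ideal_deg A i) (act g i))"

definition quasi_reflection :: "'a::field alg \<Rightarrow> 'a^2^2 \<Rightarrow> bool" where
  "quasi_reflection A g = (\<exists>p. poly p 1 \<noteq> 0 \<and> Tr A g * ((1 - fps_X) * fps_of_poly p) = 1)"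

definition is_subgroup :: "('a::field^2^2) set \<Rightarrow> bool" where
  "is_subgroup H = (mat 1 \<in> H \<and> (\<forall>g\<in>H. invertible g \<and> matrix_inv g \<in> H)
                    \<and> (\<forall>g\<in>H. \<forall>h\<in>H. g ** h \<in> H))"

definition small :: "'a::field alg \<Rightarrow> ('a^2^2) set \<Rightarrow> bool" where
  "small A G = (finite G \<and> is_subgroup G \<and> G \<subseteq> Aut A \<and> (\<forall>g\<in>G. \<not> quasi_reflection A g))"

definition gen_group :: "('a::field^2^2) set \<Rightarrow> ('a^2^2) set" where
  "gen_group S = \<Inter>{H. is_subgroup H \<and> S \<subseteq> H}"

definition primroot :: "nat \<Rightarrow> 'a::field \<Rightarrow> bool" where
  "primroot n z = (0 < n \<and> z ^ n = 1 \<and> (\<forall>m. 0 < m \<and> m < n \<longrightarrow> z ^ m \<noteq> 1))"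

text \<open>1/n(1,a) with respect to the primitive n-th root w.\<close>
definition cyc :: "'a::field \<Rightarrow> nat \<Rightarrow> ('a^2^2) set" where
  "cyc w a = gen_group {mat2 w 0 0 (w ^ a)}"

text \<open>G_{n,k} with respect to the primitive 2nk-th root w.\<close>
definition Gnk :: "nat \<Rightarrow> nat \<Rightarrow> 'a::field \<Rightarrow> ('a^2^2) set" where
  "Gnk n k w = gen_group {mat2 (w ^ (2*k)) 0 0 (inverse (w ^ (2*k))), mat2 0 (w ^ n) (w ^ n) 0}"

definition conjg :: "'a::field^2^2 \<Rightarrow> ('a^2^2) set \<Rightarrow> ('a^2^2) set" where
  "conjg h G = (\<lambda>g. h ** g ** matrix_inv h) ` G"

end

theory Submission
  imports Defs
begin

text \<open>
  Rewriting \<open>vu\<close> by the defining relation shows that the monomials \<open>u\<^sup>a v\<^sup>b\<close> form a basis of \<open>A\<close>.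
  Reading traces off this basis gives \<open>1/((1 - xt)(1 - yt))\<close> for \<open>diag(x, y)\<close> and, when \<open>q = -1\<close>,
  \<open>1/(1 + bct\<^sup>2)\<close> for the antidiagonal matrix with entries \<open>b\<close>, \<open>c\<close>. So the quasi-reflections are the
  diagonal matrices with exactly one entry equal to \<open>1\<close> and the antidiagonal ones with \<open>bc = -1\<close>.

  Graded automorphisms of \<open>k\<^sub>q[u,v]\<close> are diagonal, or antidiagonal if \<open>q = -1\<close>; those of \<open>k\<^sub>J[u,v]\<close> are
  scalar times unipotent, hence scalar if of finite order. A small diagonal group embeds into the
  multiplicative group of the field by either coordinate, so it is cyclic of type \<open>1/n(1,a)\<close>.

  Suppose \<open>G\<close> contains an antidiagonal \<open>s\<close>, and let \<open>D\<close> be its diagonal part, \<open>K\<close> the group of \<open>z\<close> with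
  \<open>diag(z, z) \<in> D\<close>, \<open>N\<close> that of \<open>t\<close> with \<open>diag(t, 1/t) \<in> D\<close>, and \<open>\<Delta>\<close> the group of all \<open>xy\<close> with
  \<open>diag(x, y) \<in> D\<close>. Conjugation by \<open>s\<close> swaps coordinates, so \<open>K\<^sup>2 \<subseteq> \<Delta> \<subseteq> K\<close>. Smallness says
  \<open>-1 \<notin> s\<^sup>2\<Delta>\<close> with \<open>s\<^sup>2 \<in> K\<close>, which forces \<open>\<Delta> = K\<^sup>2\<close> and therefore \<open>D = K N\<close>. Since \<open>K \<inter> N \<subseteq> {1, -1}\<close>,
  halving the order of \<open>K\<close> or of \<open>N\<close> if both are even makes the orders coprime.
\<close>

section \<open>Traces on quotients and normal forms\<close>

text \<open>The trace does not depend on the basis chosen in the definition: if \<open>P\<close> and \<open>Q\<close> are the transition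
  matrices to and from the basis \<open>b\<close>, then \<open>tr C = tr (Q M P) = tr (M P Q) = tr M\<close>.\<close>

lemma trace_quot_coordinates:
  fixes \<phi> :: "nat \<Rightarrow> (bool list \<Rightarrow> 'a::comm_ring_1) \<Rightarrow> 'a"
  assumes I: "I = {f \<in> tens i. \<forall>a<m. \<phi> a f = 0}"
    and diff: "\<And>a f g. \<phi> a (f - g) = \<phi> a f - \<phi> a g"
    and lin: "\<And>a B c. \<phi> a (lincomb B c) = (\<Sum>j<length B. c j * \<phi> a (B ! j))"
    and b: "\<And>r. r < m \<Longrightarrow> b r \<in> tens i"
    and \<phi>_b: "\<And>a r. a < m \<Longrightarrow> r < m \<Longrightarrow> \<phi> a (b r) = of_bool (a = r)"
    and T: "\<And>f. f \<in> tens i \<Longrightarrow> T f \<in> tens i"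
    and \<phi>_T: "\<And>f a. f \<in> tens i \<Longrightarrow> a < m \<Longrightarrow> \<phi> a (T f) = (\<Sum>r<m. M a r * \<phi> r f)"
  shows "trace_quot (tens i) I T = (\<Sum>a<m. M a a)"
proof -
  have tens_diff: "f - g \<in> tens i" if "f \<in> tens i" "g \<in> tens i" for f g :: "bool list \<Rightarrow> 'a"
    using that by (auto simp: tens_def)
  have tens_lincomb: "lincomb B c \<in> tens i" if "set B \<subseteq> tens i" for B and c :: "nat \<Rightarrow> 'a"
    using that by (auto simp: tens_def lincomb_def intro!: sum.neutral dest!: nth_mem)
  show ?thesis
    unfolding trace_quot_def
  proof (rule some_equality)
    \<comment> \<open>The vectors \<open>b\<close> dual to the coordinates form one admissible
      basis, with \<open>M\<close> as the matrix of \<open>T\<close>.\<close>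
    define B where "B = map b [0..<m]"
    have len: "length B = m" and nth: "\<And>j. j < m \<Longrightarrow> B ! j = b j" and sub: "set B \<subseteq> tens i"
      using b by (auto simp: B_def)
    have \<phi>_B: "\<phi> a (lincomb B c) = c a" if "a < m" for a c
    proof -
      have "\<phi> a (lincomb B c) = (\<Sum>j<m. c j * of_bool (a = j))"
        unfolding lin len using that by (intro sum.cong) (auto simp: nth \<phi>_b)
      thus ?thesis using that by simp
    qed
    have "\<exists>c. w - lincomb B c \<in> I" if "w \<in> tens i" for w
      using that sub by (intro exI[of _ "\<lambda>j. \<phi> j w"])
        (auto simp: I \<phi>_B diff intro!: tens_diff tens_lincomb)
    moreover have "T (B ! j) - lincomb B (\<lambda>l. M l j) \<in> I" if "j < m" for j
    proof -
      have "(\<Sum>r<m. M a r * \<phi> r (b j)) = M a j" if "a < m" for a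
      proof -
        have "(\<Sum>r<m. M a r * \<phi> r (b j)) = (\<Sum>r<m. M a r * of_bool (r = j))"
          using \<open>j < m\<close> by (intro sum.cong) (auto simp: \<phi>_b)
        thus ?thesis using \<open>j < m\<close> by simp
      qed
      thus ?thesis
        using that b sub by (auto simp: I \<phi>_B diff nth \<phi>_T intro!: tens_diff tens_lincomb T)
    qed
    moreover have "c j = 0" if "lincomb B c \<in> I" "j < m" for c j
      using that by (auto simp: I \<phi>_B)
    ultimately show "\<exists>B C. set B \<subseteq> tens i
      \<and> (\<forall>c. lincomb B c \<in> I \<longrightarrow> (\<forall>j<length B. c j = 0))
      \<and> (\<forall>w\<in>tens i. \<exists>c. w - lincomb B c \<in> I)
      \<and> (\<forall>j<length B. T (B ! j) - lincomb B (\<lambda>l. C l j) \<in> I)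
      \<and> (\<Sum>a<m. M a a) = (\<Sum>j<length B. C j j)"
      using sub len by (intro exI[of _ B] exI[of _ M]) auto
  next
    fix t
    assume "\<exists>B C. set B \<subseteq> tens i
      \<and> (\<forall>c. lincomb B c \<in> I \<longrightarrow> (\<forall>j<length B. c j = 0))
      \<and> (\<forall>w\<in>tens i. \<exists>c. w - lincomb B c \<in> I)
      \<and> (\<forall>j<length B. T (B ! j) - lincomb B (\<lambda>l. C l j) \<in> I)
      \<and> t = (\<Sum>j<length B. C j j)"
    then obtain B C where sub: "set B \<subseteq> tens i"
      and ind: "\<And>c j. lincomb B c \<in> I \<Longrightarrow> j < length B \<Longrightarrow> c j = 0"
      and span: "\<And>w. w \<in> tens i \<Longrightarrow> \<exists>c. w - lincomb B c \<in> I"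
      and TC: "\<And>j. j < length B \<Longrightarrow> T (B ! j) - lincomb B (\<lambda>l. C l j) \<in> I"
      and t: "t = (\<Sum>j<length B. C j j)" by blast
    define N where "N = length B"
    define P where "P a j = \<phi> a (B ! j)" for a j
    have "\<forall>r. \<exists>c. r < m \<longrightarrow> b r - lincomb B c \<in> I" using span b by blast
    then obtain Q where Q: "\<And>r. r < m \<Longrightarrow> b r - lincomb B (Q r) \<in> I" by metis
    have PQ: "(\<Sum>j<N. Q r j * P a j) = of_bool (a = r)" if "a < m" "r < m" for a r
      using Q[OF that(2)] that by (simp add: I diff lin N_def P_def \<phi>_b)
    have MP: "(\<Sum>r<m. M a r * P r j) = (\<Sum>l<N. C l j * P a l)" if "a < m" "j < N" for a j
    proof -
      have "\<phi> a (T (B ! j)) = (\<Sum>l<N. C l j * P a l)"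
        using TC[of j] that by (simp add: I diff lin N_def P_def)
      moreover have "B ! j \<in> tens i" using sub that by (auto simp: N_def)
      ultimately show ?thesis using \<phi>_T that by (simp add: P_def)
    qed
    \<comment> \<open>\<open>PQ\<close> comes from coordinates alone; the product in the other order
      uses the independence of \<open>B\<close>: the difference of the two sides, read as
      coefficients, gives a combination lying in \<open>I\<close>.\<close>
    have QP: "(\<Sum>a<m. Q a j * P a l) = of_bool (j = l)" if "j < N" "l < N" for j l
    proof -
      have "\<phi> r (lincomb B (\<lambda>j. (\<Sum>a<m. Q a j * P a l) - of_bool (j = l))) = 0" if "r < m" for r
      proof -
        have "\<phi> r (lincomb B (\<lambda>j. (\<Sum>a<m. Q a j * P a l) - of_bool (j = l)))
            = (\<Sum>j<N. \<Sum>a<m. Q a j * P a l * P r j) - (\<Sum>j<N. of_bool (j = l) * P r j)"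
          by (simp add: lin N_def P_def left_diff_distrib sum_subtractf sum_distrib_right)
        also have "(\<Sum>j<N. of_bool (j = l) * P r j) = P r l" using \<open>l < N\<close> by simp
        also have "(\<Sum>j<N. \<Sum>a<m. Q a j * P a l * P r j) = (\<Sum>a<m. P a l * (\<Sum>j<N. Q a j * P r j))"
          by (subst sum.swap) (simp add: sum_distrib_left mult_ac)
        also have "\<dots> = (\<Sum>a<m. P a l * of_bool (r = a))"
          using that by (intro sum.cong) (auto simp: PQ)
        also have "\<dots> = P r l" using that by simp
        finally show ?thesis by simp
      qed
      hence "lincomb B (\<lambda>j. (\<Sum>a<m. Q a j * P a l) - of_bool (j = l)) \<in> I"
        using sub by (auto simp: I intro!: tens_lincomb)
      from ind[OF this, of j] that show ?thesis by (simp add: N_def)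
    qed
    have "(\<Sum>a<m. M a a) = (\<Sum>a<m. \<Sum>r<m. M a r * of_bool (r = a))" by simp
    also have "\<dots> = (\<Sum>a<m. \<Sum>r<m. M a r * (\<Sum>j<N. Q a j * P r j))"
      by (intro sum.cong) (auto simp: PQ)
    also have "\<dots> = (\<Sum>a<m. \<Sum>r<m. \<Sum>j<N. Q a j * (M a r * P r j))"
      by (simp add: sum_distrib_left mult_ac)
    also have "\<dots> = (\<Sum>a<m. \<Sum>j<N. \<Sum>r<m. Q a j * (M a r * P r j))"
      by (intro sum.cong refl sum.swap)
    also have "\<dots> = (\<Sum>a<m. \<Sum>j<N. Q a j * (\<Sum>r<m. M a r * P r j))"
      by (simp add: sum_distrib_left)
    also have "\<dots> = (\<Sum>a<m. \<Sum>j<N. Q a j * (\<Sum>l<N. C l j * P a l))"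
      by (intro sum.cong) (auto simp: MP)
    also have "\<dots> = (\<Sum>j<N. \<Sum>a<m. \<Sum>l<N. Q a j * (C l j * P a l))"
      by (subst sum.swap) (simp add: sum_distrib_left)
    also have "\<dots> = (\<Sum>j<N. \<Sum>l<N. \<Sum>a<m. Q a j * (C l j * P a l))"
      by (intro sum.cong refl sum.swap)
    also have "\<dots> = (\<Sum>j<N. \<Sum>l<N. C l j * (\<Sum>a<m. Q a j * P a l))"
      by (simp add: sum_distrib_left mult_ac)
    also have "\<dots> = (\<Sum>j<N. \<Sum>l<N. C l j * of_bool (j = l))"
      by (intro sum.cong) (auto simp: QP)
    also have "\<dots> = t" by (simp add: t N_def)
    finally show "t = (\<Sum>a<m. M a a)" by simp
  qed
qed

text \<open>\<open>nf A w a\<close> is the coefficient of \<open>u\<^sup>a v\<^sup>b\<close>, \<open>a + b = length w\<close>, in the word \<open>w\<close>. The clauses for \<open>True\<close>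
  come from \<open>v u\<^sup>a = q\<^sup>a u\<^sup>a v\<close> in \<open>k\<^sub>q[u,v]\<close> and \<open>v u\<^sup>a = u\<^sup>a v + a u\<^sup>a\<^sup>+\<^sup>1\<close> in \<open>k\<^sub>J[u,v]\<close>.\<close>

fun nf :: "'a::comm_ring_1 alg \<Rightarrow> bool list \<Rightarrow> nat \<Rightarrow> 'a" where
  "nf A [] a = of_bool (a = 0)"
| "nf A (False # w) a = (case a of 0 \<Rightarrow> 0 | Suc a' \<Rightarrow> nf A w a')"
| "nf (Qalg q) (True # w) a = q ^ a * nf (Qalg q) w a"
| "nf Jalg (True # w) a =
     nf Jalg w a + (case a of 0 \<Rightarrow> 0 | Suc a' \<Rightarrow> of_nat a' * nf Jalg w a')"

text \<open>Linear extension of \<open>nf\<close>: the coefficient of \<open>u^a v^(i-a)\<close> in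
  the image of \<open>f\<close> in the degree \<open>i\<close> part of \<open>A\<close>.\<close>

definition coord :: "'a::comm_ring_1 alg \<Rightarrow> nat \<Rightarrow> nat \<Rightarrow> (bool list \<Rightarrow> 'a) \<Rightarrow> 'a" where
  "coord A i a f = (\<Sum>w\<in>words i. f w * nf A w a)"

definition word_elt :: "bool list \<Rightarrow> bool list \<Rightarrow> 'a::comm_ring_1" where
  "word_elt v = (\<lambda>w. of_bool (w = v))"

definition pbw :: "nat \<Rightarrow> nat \<Rightarrow> bool list" where
  "pbw i a = replicate a False @ replicate (i - a) True"

lemma finite_words [simp]: "finite (words i)"
  using finite_lists_length_eq[of "UNIV :: bool set" i] by (simp add: words_def)

lemma words_0: "words 0 = {[]}"
  by (auto simp: words_def)

lemma words_Suc: "words (Suc i) = (#) True ` words i \<union> (#) False ` words i"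
  by (auto simp: words_def length_Suc_conv)

lemma sum_words_Suc:
  "(\<Sum>w\<in>words (Suc i). f w) = (\<Sum>w\<in>words i. f (True # w)) + (\<Sum>w\<in>words i. f (False # w))"
  unfolding words_Suc by (subst sum.union_disjoint) (auto simp: sum.reindex)

lemma coord_diff: "coord A i a (f - g) = coord A i a f - coord A i a g"
  by (simp add: coord_def left_diff_distrib sum_subtractf)

lemma coord_lincomb: "coord A i a (lincomb B c) = (\<Sum>j<length B. c j * coord A i a (B ! j))"
  unfolding coord_def lincomb_def sum_distrib_right sum_distrib_left
  by (subst sum.swap) (simp add: mult_ac)

lemma coord_word_elt: "length v = i \<Longrightarrow> coord A i a (word_elt v) = nf A v a"
  by (simp add: coord_def word_elt_def words_def[symmetric] of_bool_def if_distrib if_distribR cong: if_cong)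
     (simp add: words_def)

lemma nf_replicate_True: "nf A (replicate j True) a = of_bool (a = 0)"
proof (induction j arbitrary: a)
  case (Suc j)
  thus ?case by (cases A) (auto split: nat.splits)
qed auto

text \<open>Ordered words are already reduced, so the coordinates are dual to them; this gives the
  independence of the monomials.\<close>

lemma nf_pbw: "nf A (pbw i r) a = of_bool (a = r)"
  unfolding pbw_def
proof (induction r arbitrary: a i)
  case 0
  thus ?case by (simp add: nf_replicate_True)
next
  case (Suc r)
  from Suc[of "i - 1"] show ?case by (auto split: nat.splits)
qed

lemma length_pbw: "a \<le> i \<Longrightarrow> length (pbw i a) = i"
  by (simp add: pbw_def)

text \<open>Left multiplication by a generator in the free algebra, matching the recursion of
  \<open>nf\<close> on the first letter.\<close>

definition lmul :: "bool \<Rightarrow> (bool list \<Rightarrow> 'a::comm_ring_1) \<Rightarrow> bool list \<Rightarrow> 'a" where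
  "lmul x f = (\<lambda>w. case w of [] \<Rightarrow> 0 | y # w' \<Rightarrow> if y = x then f w' else 0)"

text \<open>Here and in the next two lemmas the coordinates of the product depend only on those of
  \<open>f\<close>, so left multiplication preserves the common kernel of all coordinates.\<close>

lemma coord_lmul_False:
  "coord A (Suc i) a (lmul False f) = (case a of 0 \<Rightarrow> 0 | Suc a' \<Rightarrow> coord A i a' f)"
  by (cases a) (simp_all add: coord_def sum_words_Suc lmul_def)

lemma coord_lmul_True_Qalg:
  "coord (Qalg q) (Suc i) a (lmul True f) = q ^ a * coord (Qalg q) i a f"
  by (simp add: coord_def sum_words_Suc lmul_def sum_distrib_left mult_ac)

lemma coord_lmul_True_Jalg:
  "coord Jalg (Suc i) a (lmul True f) =
     coord Jalg i a f + (case a of 0 \<Rightarrow> 0 | Suc a' \<Rightarrow> of_nat a' * coord Jalg i a' f)"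
  by (cases a) (simp_all add: coord_def sum_words_Suc lmul_def sum_distrib_left sum.distrib
      algebra_simps)

lemma lmul_embed: "lmul x (embed w1 r w2) = embed (x # w1) r w2"
  by (rule ext) (auto simp: lmul_def embed_def split: list.splits)

lemma embed_Nil_rel_Qalg:
  "embed [] (rel (Qalg q)) w2 = (\<lambda>w. word_elt (True # False # w2) w - q * word_elt (False # True # w2) w)"
proof
  fix w :: "bool list"
  consider "w = []" | x where "w = [x]" | x y v where "w = x # y # v"
    by (metis list.exhaust)
  thus "embed [] (rel (Qalg q)) w2 w = word_elt (True # False # w2) w - q * word_elt (False # True # w2) w"
    by cases (auto simp: embed_def word_elt_def)
qed

lemma embed_Nil_rel_Jalg:
  "embed [] (rel Jalg) w2 = (\<lambda>w. word_elt (True # False # w2) w - word_elt (False # True # w2) w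
     - word_elt (False # False # w2) w)"
proof
  fix w :: "bool list"
  consider "w = []" | x where "w = [x]" | x y v where "w = x # y # v"
    by (metis list.exhaust)
  thus "embed [] (rel Jalg) w2 w = word_elt (True # False # w2) w - word_elt (False # True # w2) w
     - (word_elt (False # False # w2) w :: 'a)"
    by cases (auto simp: embed_def word_elt_def)
qed


section \<open>The graded pieces of the defining ideal\<close>

lemma ideal_deg_embed:
  assumes "length w1 + length w2 + 2 = i"
  shows "embed w1 (rel A) w2 \<in> ideal_deg A i"
  unfolding ideal_deg_def
proof (intro CollectI exI conjI)
  show "embed w1 (rel A) w2 = lincomb [embed w1 (rel A) w2] (\<lambda>_. 1)"
    by (simp add: lincomb_def)
  show "set [embed w1 (rel A) w2] \<subseteq> {embed w1 (rel A) w2 | w1 w2. length w1 + length w2 + 2 = i}"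
    using assms by auto
qed

lemma ideal_deg_zero: "(\<lambda>_. 0) \<in> ideal_deg A i"
  unfolding ideal_deg_def by (intro CollectI exI[of _ "[]"]) (auto simp: lincomb_def)

lemma ideal_deg_scale:
  assumes "f \<in> ideal_deg A i"
  shows "(\<lambda>v. x * f v) \<in> ideal_deg A i"
proof -
  obtain B c where B: "set B \<subseteq> {embed w1 (rel A) w2 | w1 w2. length w1 + length w2 + 2 = i}"
    and f: "f = lincomb B c" using assms unfolding ideal_deg_def by blast
  have "(\<lambda>v. x * f v) = lincomb B (\<lambda>j. x * c j)"
    by (simp add: f lincomb_def sum_distrib_left mult.assoc)
  thus ?thesis using B unfolding ideal_deg_def by blast
qed

lemma ideal_deg_add:
  assumes "f \<in> ideal_deg A i" "g \<in> ideal_deg A i"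
  shows "(\<lambda>v. f v + g v) \<in> ideal_deg A i"
proof -
  obtain B c where B: "set B \<subseteq> {embed w1 (rel A) w2 | w1 w2. length w1 + length w2 + 2 = i}"
    and f: "f = lincomb B c" using assms(1) unfolding ideal_deg_def by blast
  obtain B' c' where B': "set B' \<subseteq> {embed w1 (rel A) w2 | w1 w2. length w1 + length w2 + 2 = i}"
    and g: "g = lincomb B' c'" using assms(2) unfolding ideal_deg_def by blast
  have split: "{..<length B + length B'} = {..<length B} \<union> (\<lambda>j. length B + j) ` {..<length B'}"
  proof (intro equalityI subsetI)
    fix j assume j: "j \<in> {..<length B + length B'}"
    show "j \<in> {..<length B} \<union> (\<lambda>j. length B + j) ` {..<length B'}"
    proof (cases "j < length B")
      case False
      with j have "j = length B + (j - length B)" "j - length B < length B'" by auto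
      thus ?thesis by blast
    qed auto
  qed auto
  have "(\<lambda>v. f v + g v) =
      lincomb (B @ B') (\<lambda>j. if j < length B then c j else c' (j - length B))"
    unfolding f g lincomb_def length_append split
    by (subst sum.union_disjoint) (auto simp: sum.reindex nth_append)
  moreover have "set (B @ B') \<subseteq> {embed w1 (rel A) w2 | w1 w2. length w1 + length w2 + 2 = i}"
    using B B' by auto
  ultimately show ?thesis unfolding ideal_deg_def by blast
qed

lemma ideal_deg_sum:
  assumes "\<And>a. a \<in> S \<Longrightarrow> f a \<in> ideal_deg A i"
  shows "(\<lambda>v. \<Sum>a\<in>S. c a * f a v) \<in> ideal_deg A i"
  using assms
proof (induction S rule: infinite_finite_induct)
  case (insert a S)
  thus ?case by (auto intro!: ideal_deg_add ideal_deg_scale)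
qed (auto simp: ideal_deg_zero)

lemma ideal_deg_lmul:
  assumes "f \<in> ideal_deg A i"
  shows "lmul x f \<in> ideal_deg A (Suc i)"
proof -
  obtain B c where B: "set B \<subseteq> {embed w1 (rel A) w2 | w1 w2. length w1 + length w2 + 2 = i}"
    and f: "f = lincomb B c" using assms unfolding ideal_deg_def by blast
  have "lmul x f = lincomb (map (lmul x) B) c"
    by (rule ext) (auto simp: f lincomb_def lmul_def split: list.splits)
  moreover have "set (map (lmul x) B) \<subseteq> {embed w1 (rel A) w2 | w1 w2. length w1 + length w2 + 2 = Suc i}"
  proof
    fix g assume "g \<in> set (map (lmul x) B)"
    then obtain w1 w2 where "g = embed (x # w1) (rel A) w2" "length (x # w1) + length w2 + 2 = Suc i"
      using B by (auto simp: lmul_embed)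
    thus "g \<in> {embed w1 (rel A) w2 | w1 w2. length w1 + length w2 + 2 = Suc i}" by blast
  qed
  ultimately show ?thesis unfolding ideal_deg_def by blast
qed

section \<open>Rewriting words to ordered monomials modulo the ideal\<close>

definition cong_ideal :: "'a::comm_ring_1 alg \<Rightarrow> nat \<Rightarrow> (bool list \<Rightarrow> 'a) \<Rightarrow> (bool list \<Rightarrow> 'a) \<Rightarrow> bool" where
  "cong_ideal A i f g \<longleftrightarrow> (\<lambda>v. f v - g v) \<in> ideal_deg A i"

lemma cong_ideal_refl: "cong_ideal A i f f"
  by (simp add: cong_ideal_def ideal_deg_zero)

lemma cong_ideal_trans: "cong_ideal A i f g \<Longrightarrow> cong_ideal A i g h \<Longrightarrow> cong_ideal A i f h"
  unfolding cong_ideal_def by (drule (1) ideal_deg_add) simp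

lemma cong_ideal_sum:
  assumes "\<And>a. a \<in> S \<Longrightarrow> cong_ideal A i (f a) (g a)"
  shows "cong_ideal A i (\<lambda>v. \<Sum>a\<in>S. c a * f a v) (\<lambda>v. \<Sum>a\<in>S. c a * g a v)"
  using ideal_deg_sum[of S "\<lambda>a v. f a v - g a v" A i c] assms
  by (simp add: cong_ideal_def right_diff_distrib sum_subtractf)

lemma cong_ideal_add:
  "cong_ideal A i f g \<Longrightarrow> cong_ideal A i f' g' \<Longrightarrow> cong_ideal A i (\<lambda>v. f v + f' v) (\<lambda>v. g v + g' v)"
  unfolding cong_ideal_def by (drule (1) ideal_deg_add) (simp add: algebra_simps)

lemma cong_ideal_scale:
  "cong_ideal A i f g \<Longrightarrow> cong_ideal A i (\<lambda>v. x * f v) (\<lambda>v. x * g v)"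
  unfolding cong_ideal_def by (drule ideal_deg_scale[of _ _ _ x]) (simp add: algebra_simps)

lemma cong_ideal_lmul:
  assumes "cong_ideal A i f g"
  shows "cong_ideal A (Suc i) (lmul x f) (lmul x g)"
proof -
  have "lmul x (\<lambda>v. f v - g v) = (\<lambda>v. lmul x f v - lmul x g v)"
    by (rule ext) (auto simp: lmul_def split: list.splits)
  thus ?thesis using ideal_deg_lmul[of "\<lambda>v. f v - g v" A i x] assms by (simp add: cong_ideal_def)
qed

lemma lmul_word_elt: "lmul x (word_elt w) = word_elt (x # w)"
  by (rule ext) (auto simp: lmul_def word_elt_def split: list.splits)

lemma lmul_sum: "lmul x (\<lambda>v. \<Sum>a\<in>S. c a * f a v) = (\<lambda>v. \<Sum>a\<in>S. c a * lmul x (f a) v)"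
  by (rule ext) (auto simp: lmul_def split: list.splits)

lemma lmul_add_scale: "lmul x (\<lambda>v. f v + c * g v) = (\<lambda>v. lmul x f v + c * lmul x g v)"
  by (rule ext) (auto simp: lmul_def split: list.splits)

lemma lmul_scale: "lmul x (\<lambda>v. c * g v) = (\<lambda>v. c * lmul x g v)"
  by (rule ext) (auto simp: lmul_def split: list.splits)

lemma pbw_Suc_Suc: "pbw (Suc i) (Suc a) = False # pbw i a"
  by (simp add: pbw_def)

lemma pbw_Suc_0: "pbw (Suc i) 0 = True # pbw i 0"
  by (simp add: pbw_def)

text \<open>One use of the relation moves \<open>v\<close> past the first \<open>u\<close>; the
  induction hypothesis, multiplied by \<open>u\<close> on the left, moves it past the
  others.\<close>

lemma True_pbw_Qalg:
  "a \<le> i \<Longrightarrow> cong_ideal (Qalg q) (Suc i) (word_elt (True # pbw i a))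
     (\<lambda>v. q ^ a * word_elt (pbw (Suc i) a) v)"
proof (induction a arbitrary: i)
  case 0
  show ?case by (simp add: pbw_Suc_0 cong_ideal_refl)
next
  case (Suc a)
  then obtain j where i: "i = Suc j" and a: "a \<le> j" by (cases i) auto
  let ?w = "pbw j a"
  have "cong_ideal (Qalg q) (Suc i) (word_elt (True # False # ?w)) (\<lambda>v. q * word_elt (False # True # ?w) v)"
    unfolding cong_ideal_def embed_Nil_rel_Qalg[symmetric]
    using a by (intro ideal_deg_embed) (simp add: i length_pbw)
  moreover have "cong_ideal (Qalg q) (Suc i) (\<lambda>v. q * word_elt (False # True # ?w) v)
      (\<lambda>v. q * (q ^ a * word_elt (False # pbw (Suc j) a) v))"
    using cong_ideal_scale[OF cong_ideal_lmul[OF Suc.IH[OF a], of False], of q]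
    by (simp add: i lmul_word_elt lmul_scale)
  ultimately show ?case
    by (auto simp: i pbw_Suc_Suc mult.assoc dest: cong_ideal_trans)
qed

text \<open>Each passage of \<open>v\<close> across a \<open>u\<close> leaves an extra term in which
  \<open>v\<close> has become \<open>u\<close>. The \<open>a\<close> crossings give equal terms,
  hence the factor \<open>of_nat a\<close>.\<close>

lemma True_pbw_Jalg:
  "a \<le> i \<Longrightarrow> cong_ideal (Jalg :: 'a::comm_ring_1 alg) (Suc i) (word_elt (True # pbw i a))
     (\<lambda>v. word_elt (pbw (Suc i) a) v + of_nat a * word_elt (pbw (Suc i) (Suc a)) v)"
proof (induction a arbitrary: i)
  case 0
  show ?case by (simp add: pbw_Suc_0 cong_ideal_refl)
next
  case (Suc a)
  then obtain j where i: "i = Suc j" and a: "a \<le> j" by (cases i) auto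
  let ?w = "pbw j a"
  have "cong_ideal (Jalg :: 'a alg) (Suc i) (word_elt (True # False # ?w))
      (\<lambda>v. word_elt (False # True # ?w) v + word_elt (False # False # ?w) v)"
    unfolding cong_ideal_def diff_diff_eq[symmetric] embed_Nil_rel_Jalg[symmetric]
    using a by (intro ideal_deg_embed) (simp add: i length_pbw)
  moreover have "cong_ideal (Jalg :: 'a alg) (Suc i)
      (\<lambda>v. word_elt (False # True # ?w) v + word_elt (False # False # ?w) v)
      (\<lambda>v. (word_elt (False # pbw (Suc j) a) v + of_nat a * word_elt (False # pbw (Suc j) (Suc a)) v)
         + word_elt (False # False # ?w) v)"
    using cong_ideal_lmul[OF Suc.IH[OF a], of False]
    by (intro cong_ideal_add cong_ideal_refl) (simp add: i lmul_word_elt lmul_add_scale)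
  ultimately have "cong_ideal (Jalg :: 'a alg) (Suc i) (word_elt (True # False # ?w))
      (\<lambda>v. (word_elt (False # pbw (Suc j) a) v + of_nat a * word_elt (False # pbw (Suc j) (Suc a)) v)
         + word_elt (False # False # ?w) v)"
    by (rule cong_ideal_trans)
  thus ?case by (simp add: i pbw_Suc_Suc algebra_simps)
qed

lemma nf_eq_0: "length w < a \<Longrightarrow> nf A w a = 0"
proof (induction w arbitrary: a)
  case (Cons x w)
  then show ?case by (cases x; cases A; cases a) auto
qed auto

text \<open>The spanning half of the basis statement: reduce the tail by induction, then move the
  first letter into place. The coefficients obtained follow the recursion of
  \<open>nf\<close>.\<close>

lemma word_cong_pbw:
  "length w = i \<Longrightarrow> cong_ideal A i (word_elt w) (\<lambda>v. \<Sum>a\<le>i. nf A w a * word_elt (pbw i a) v)"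
proof (induction w arbitrary: i)
  case Nil
  thus ?case by (simp add: pbw_def cong_ideal_refl)
next
  case (Cons x w)
  then obtain j where i: "i = Suc j" and j: "length w = j" by auto
  have *: "cong_ideal A i (word_elt (x # w)) (\<lambda>v. \<Sum>a\<le>j. nf A w a * word_elt (x # pbw j a) v)"
    using cong_ideal_lmul[OF Cons.IH[OF j], of x] by (simp add: i lmul_word_elt lmul_sum)
  show ?case
  proof (cases x)
    case False
    thus ?thesis using * by (simp add: i sum.atMost_Suc_shift pbw_Suc_Suc del: sum.atMost_Suc)
  next
    case True
    show ?thesis
    proof (cases A)
      case (Qalg q)
      have "cong_ideal A i (\<lambda>v. \<Sum>a\<le>j. nf A w a * word_elt (x # pbw j a) v)
         (\<lambda>v. \<Sum>a\<le>j. nf A w a * (q ^ a * word_elt (pbw i a) v))"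
        by (rule cong_ideal_sum) (auto simp: True i Qalg intro: True_pbw_Qalg)
      also have "(\<lambda>v. \<Sum>a\<le>j. nf A w a * (q ^ a * word_elt (pbw i a) v))
          = (\<lambda>v. \<Sum>a\<le>i. nf A (x # w) a * word_elt (pbw i a) v)"
        \<comment> \<open>The sum up to \<open>i\<close> has one more term, at
          \<open>a = Suc j\<close>, where \<open>nf\<close> of the shorter word vanishes.\<close>
        by (simp add: i True Qalg nf_eq_0 j mult_ac)
      finally show ?thesis using * cong_ideal_trans by blast
    next
      case Jalg
      have "cong_ideal A i (\<lambda>v. \<Sum>a\<le>j. nf A w a * word_elt (x # pbw j a) v)
         (\<lambda>v. \<Sum>a\<le>j. nf A w a * (word_elt (pbw i a) v + of_nat a * word_elt (pbw i (Suc a)) v))"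
        by (rule cong_ideal_sum) (auto simp: True i Jalg intro: True_pbw_Jalg)
      also have "(\<lambda>v. \<Sum>a\<le>j. nf A w a * (word_elt (pbw i a) v + of_nat a * word_elt (pbw i (Suc a)) v))
          = (\<lambda>v. \<Sum>a\<le>i. nf A (x # w) a * word_elt (pbw i a) v)" (is "?l = ?r")
      proof
        fix v
        have "?r v = (\<Sum>a\<le>i. nf A w a * word_elt (pbw i a) v)
            + (\<Sum>a\<le>i. (case a of 0 \<Rightarrow> 0 | Suc a' \<Rightarrow> of_nat a' * nf A w a') * word_elt (pbw i a) v)"
          unfolding Jalg by (simp add: True distrib_right sum.distrib del: sum.atMost_Suc)
        also have "(\<Sum>a\<le>i. nf A w a * word_elt (pbw i a) v) = (\<Sum>a\<le>j. nf A w a * word_elt (pbw i a) v)"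
          by (simp add: i nf_eq_0 j)
        \<comment> \<open>The term at \<open>a = 0\<close> is zero, so shifting the index by one
          returns to the range up to \<open>j\<close>.\<close>
        also have "(\<Sum>a\<le>i. (case a of 0 \<Rightarrow> 0 | Suc a' \<Rightarrow> of_nat a' * nf A w a') * word_elt (pbw i a) v)
            = (\<Sum>a\<le>j. of_nat a * nf A w a * word_elt (pbw i (Suc a)) v)"
          by (simp add: i sum.atMost_Suc_shift del: sum.atMost_Suc)
        finally show "?l v = ?r v" by (simp add: distrib_left sum.distrib mult_ac)
      qed
      finally show ?thesis using * cong_ideal_trans by blast
    qed
  qed
qed

text \<open>For an empty prefix this is the compatibility of the clauses of \<open>nf\<close> with
  the relation; a longer prefix is a left multiplication, which keeps all coordinates zero.\<close>

lemma coord_embed_eq_0: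
  "length w1 + length w2 + 2 = i \<Longrightarrow> coord A i a (embed w1 (rel A) w2) = 0"
proof (induction w1 arbitrary: i a)
  case Nil
  show ?case
  proof (cases A)
    case (Qalg q)
    have "coord A i a (embed [] (rel A) w2)
        = coord A i a (word_elt (True # False # w2)) - q * coord A i a (word_elt (False # True # w2))"
      by (simp add: Qalg embed_Nil_rel_Qalg coord_def sum_distrib_left sum_subtractf algebra_simps del: rel.simps)
    thus ?thesis using Nil by (simp add: coord_word_elt Qalg split: nat.splits)
  next
    case Jalg
    have "coord A i a (embed [] (rel A) w2)
        = coord A i a (word_elt (True # False # w2)) - coord A i a (word_elt (False # True # w2))
          - coord A i a (word_elt (False # False # w2))"
      by (simp add: Jalg embed_Nil_rel_Jalg coord_def sum_subtractf sum.distrib algebra_simps del: rel.simps)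
    thus ?thesis using Nil by (simp add: coord_word_elt Jalg algebra_simps split: nat.splits)
  qed
next
  case (Cons x w1)
  then obtain j where i: "i = Suc j" and j: "length w1 + length w2 + 2 = j" by (cases i) auto
  show ?case
    unfolding i lmul_embed[symmetric] using Cons.IH[OF j]
    by (cases x; cases A)
       (auto simp: coord_lmul_False coord_lmul_True_Qalg coord_lmul_True_Jalg split: nat.splits)
qed

text \<open>Generators of the ideal have zero coordinates. Conversely, \<open>f\<close> is congruent
  to the combination of ordered monomials whose coefficients are its coordinates, hence to zero when
  these vanish.\<close>

lemma ideal_deg_eq_kernel:
  "ideal_deg A i = {f \<in> tens i. \<forall>a<Suc i. coord A i a f = 0}"
proof (intro equalityI subsetI)
  fix f assume "f \<in> ideal_deg A i"
  then obtain B c where B: "set B \<subseteq> {embed w1 (rel A) w2 | w1 w2. length w1 + length w2 + 2 = i}"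
    and f: "f = lincomb B c" unfolding ideal_deg_def by blast
  have "B ! j \<in> tens i \<and> coord A i a (B ! j) = 0" if "j < length B" for j a
  proof -
    have "B ! j \<in> {embed w1 (rel A) w2 | w1 w2. length w1 + length w2 + 2 = i}"
      using B nth_mem[OF that] by (rule subsetD)
    then obtain w1 w2 where "B ! j = embed w1 (rel A) w2" "length w1 + length w2 + 2 = i"
      by (elim CollectE exE conjE)
    thus ?thesis by (simp add: coord_embed_eq_0) (auto simp: tens_def embed_def)
  qed
  thus "f \<in> {f \<in> tens i. \<forall>a<Suc i. coord A i a f = 0}"
    by (auto simp: f coord_lincomb) (auto simp: tens_def lincomb_def intro!: sum.neutral)
next
  fix f assume f: "f \<in> {f \<in> tens i. \<forall>a<Suc i. coord A i a f = 0}"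
  have "cong_ideal A i (\<lambda>v. \<Sum>w\<in>words i. f w * word_elt w v)
     (\<lambda>v. \<Sum>w\<in>words i. f w * (\<Sum>a\<le>i. nf A w a * word_elt (pbw i a) v))"
    by (rule cong_ideal_sum) (auto simp: words_def intro: word_cong_pbw)
  also have "(\<lambda>v. \<Sum>w\<in>words i. f w * (\<Sum>a\<le>i. nf A w a * word_elt (pbw i a) v)) = (\<lambda>v. 0)"
  proof
    fix v
    have "(\<Sum>w\<in>words i. f w * (\<Sum>a\<le>i. nf A w a * word_elt (pbw i a) v))
        = (\<Sum>a\<le>i. coord A i a f * word_elt (pbw i a) v)"
      unfolding coord_def sum_distrib_left sum_distrib_right
      by (subst sum.swap) (simp add: mult_ac)
    also have "\<dots> = 0" using f by (intro sum.neutral) auto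
    finally show "(\<Sum>w\<in>words i. f w * (\<Sum>a\<le>i. nf A w a * word_elt (pbw i a) v)) = 0" .
  qed
  also have "(\<lambda>v. \<Sum>w\<in>words i. f w * word_elt w v) = f"
  proof
    fix v
    have "(\<Sum>w\<in>words i. f w * word_elt w v) = (\<Sum>w\<in>words i. if w = v then f v else 0)"
      by (intro sum.cong) (auto simp: word_elt_def)
    also have "\<dots> = (if v \<in> words i then f v else 0)" by simp
    also have "\<dots> = f v" using f by (auto simp: tens_def words_def)
    finally show "(\<Sum>w\<in>words i. f w * word_elt w v) = f v" .
  qed
  finally show "f \<in> ideal_deg A i" by (simp add: cong_ideal_def)
qed

lemma trace_quot_coord:
  assumes "\<And>f a. f \<in> tens i \<Longrightarrow> a \<le> i \<Longrightarrow> coord A i a (act g i f) = (\<Sum>r\<le>i. M a r * coord A i r f)"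
  shows "trace_quot (tens i) (ideal_deg A i) (act g i) = (\<Sum>a\<le>i. M a a)"
proof -
  have "trace_quot (tens i) (ideal_deg A i) (act g i) = (\<Sum>a<Suc i. M a a)"
  proof (rule trace_quot_coordinates[OF ideal_deg_eq_kernel coord_diff coord_lincomb,
        where b = "\<lambda>a. word_elt (pbw i a)" and M = M])
    show "word_elt (pbw i r) \<in> tens i" if "r < Suc i" for r
      using that by (auto simp: tens_def word_elt_def length_pbw)
    show "coord A i a (word_elt (pbw i r)) = of_bool (a = r)" if "a < Suc i" "r < Suc i" for a r
      using that by (simp add: coord_word_elt length_pbw nf_pbw)
    show "act g i f \<in> tens i" for f by (simp add: tens_def act_def)
    show "coord A i a (act g i f) = (\<Sum>r<Suc i. M a r * coord A i r f)"
      if "f \<in> tens i" "a < Suc i" for f a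
      using assms that by (simp add: lessThan_Suc_atMost del: sum.lessThan_Suc)
  qed
  thus ?thesis by (simp add: lessThan_Suc_atMost del: sum.lessThan_Suc)
qed

section \<open>Traces and quasi-reflections\<close>

lemma gc_mat2: "gc (mat2 a b c d) x y = (if y then (if x then d else c) else (if x then b else a))"
  by (simp add: gc_def mat2_def idx_def)

lemma coord_act:
  "coord A i a (act g i f) =
     (\<Sum>w\<in>words i. f w * (\<Sum>w'\<in>words i. (\<Prod>j<i. gc g (w ! j) (w' ! j)) * nf A w' a))"
proof -
  have "coord A i a (act g i f) =
      (\<Sum>w'\<in>words i. \<Sum>w\<in>words i. f w * ((\<Prod>j<i. gc g (w ! j) (w' ! j)) * nf A w' a))"
    unfolding coord_def by (intro sum.cong) (auto simp: act_def words_def sum_distrib_right mult.assoc)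
  also have "\<dots> = (\<Sum>w\<in>words i. \<Sum>w'\<in>words i. f w * ((\<Prod>j<i. gc g (w ! j) (w' ! j)) * nf A w' a))"
    by (rule sum.swap)
  finally show ?thesis by (simp add: sum_distrib_left)
qed

lemma prod_gc_diag:
  fixes x y :: "'a::comm_ring_1"
  assumes "w \<in> words i" "w' \<in> words i"
  shows "(\<Prod>j<i. gc (mat2 x 0 0 y) (w ! j) (w' ! j)) =
     of_bool (w' = w) * (x ^ count_list w False * y ^ count_list w True)"
  using assms
proof (induction i arbitrary: w w')
  case (Suc i)
  then obtain p v p' v' where w: "w = p # v" "v \<in> words i" "w' = p' # v'" "v' \<in> words i"
    by (auto simp: words_Suc)
  show ?case
    unfolding w(1,3) prod.lessThan_Suc_shift nth_Cons_0 nth_Cons_Suc Suc.IH[OF w(2,4)]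
    by (cases p; cases p') (simp_all add: gc_mat2 mult_ac)
qed (simp add: words_0)

text \<open>The matrix sends \<open>u\<close> to \<open>c v\<close> and \<open>v\<close> to
  \<open>b u\<close>, so a word goes to a multiple of its letterwise complement.\<close>

lemma prod_gc_antidiag:
  fixes b c :: "'a::comm_ring_1"
  assumes "w \<in> words i" "w' \<in> words i"
  shows "(\<Prod>j<i. gc (mat2 0 b c 0) (w ! j) (w' ! j)) =
     of_bool (w' = map Not w) * (c ^ count_list w False * b ^ count_list w True)"
  using assms
proof (induction i arbitrary: w w')
  case (Suc i)
  then obtain p v p' v' where w: "w = p # v" "v \<in> words i" "w' = p' # v'" "v' \<in> words i"
    by (auto simp: words_Suc)
  show ?case
    unfolding w(1,3) prod.lessThan_Suc_shift nth_Cons_0 nth_Cons_Suc Suc.IH[OF w(2,4)]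
    by (cases p; cases p') (simp_all add: gc_mat2 mult_ac)
qed (simp add: words_0)

lemma sum_of_bool_word:
  fixes c :: "'a::comm_ring_1"
  assumes "v \<in> words i"
  shows "(\<Sum>w\<in>words i. of_bool (w = v) * c * h w) = c * h v"
proof -
  have "(\<Sum>w\<in>words i. of_bool (w = v) * c * h w) = (\<Sum>w\<in>words i. if w = v then c * h w else 0)"
    by (intro sum.cong) auto
  thus ?thesis using assms by simp
qed

lemma coord_act_diag:
  "coord A i a (act (mat2 x 0 0 y) i f) =
     (\<Sum>w\<in>words i. f w * (x ^ count_list w False * y ^ count_list w True * nf A w a))"
  unfolding coord_act
  by (intro sum.cong refl arg_cong2[where f = "(*)"]) (simp add: prod_gc_diag sum_of_bool_word)

lemma coord_act_antidiag:
  "coord A i a (act (mat2 0 b c 0) i f) =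
     (\<Sum>w\<in>words i. f w * (c ^ count_list w False * b ^ count_list w True * nf A (map Not w) a))"
proof -
  have "map Not w \<in> words i" if "w \<in> words i" for w using that by (simp add: words_def)
  thus ?thesis unfolding coord_act
    by (intro sum.cong refl arg_cong2[where f = "(*)"]) (simp add: prod_gc_antidiag sum_of_bool_word)
qed

text \<open>The relation \<open>vu = q uv\<close> preserves the number of letters \<open>u\<close>,
  so a word has at most one nonzero coordinate.\<close>

lemma nf_Qalg_eq_0: "count_list w False \<noteq> a \<Longrightarrow> nf (Qalg q) w a = 0"
proof (induction w arbitrary: a)
  case (Cons x w)
  thus ?case by (cases x) (auto split: nat.splits)
qed auto

lemma count_list_True: "count_list w True = length w - count_list w False"
proof (induction w)
  case (Cons x w)
  thus ?case using count_le_length[of w False] by auto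
qed simp

text \<open>Exchanging the letters turns \<open>u^(n-a) v^a\<close> into \<open>v^(n-a) u^a\<close>,
  and sorting this at \<open>q = -1\<close> costs one sign for each of the
  \<open>a * (n - a)\<close> crossings.\<close>

lemma nf_map_Not:
  fixes w :: "bool list"
  assumes "a \<le> length w"
  shows "nf (Qalg (-1 :: 'a::comm_ring_1)) (map Not w) a =
     (-1) ^ (a * (length w - a)) * nf (Qalg (-1)) w (length w - a)"
  using assms
proof (induction w arbitrary: a)
  case (Cons x w)
  show ?case
  proof (cases x)
    case False
    show ?thesis
    proof (cases "a \<le> length w")
      case True
      hence "Suc (length w) - a = Suc (length w - a)" by simp
      thus ?thesis using False Cons.IH[OF True] by (simp add: power_add)
    next
      case nle: False
      hence "a = Suc (length w)" using Cons.prems by simp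
      thus ?thesis using False by (simp add: nf_eq_0)
    qed
  next
    case True
    show ?thesis
    proof (cases a)
      case 0
      thus ?thesis using True by (simp add: nf_eq_0)
    next
      case (Suc b)
      hence "b \<le> length w" using Cons.prems by simp
      \<comment> \<open>The sign \<open>(-1) ^ (length w - b)\<close> enters twice, from the
        exponent and from the clause of \<open>nf\<close> for \<open>True\<close>, and
        cancels.\<close>
      from Cons.IH[OF this] show ?thesis using True Suc
        by (cases "(-1 :: 'a) ^ (length w - b) = 1") (auto simp: power_add minus_one_power_iff simp del: even_diff_nat)
    qed
  qed
qed simp

lemma trace_diag_Qalg:
  "trace_quot (tens i) (ideal_deg (Qalg q) i) (act (mat2 x 0 0 y) i) = (\<Sum>a\<le>i. x ^ a * y ^ (i - a))"
proof -
  let ?M = "\<lambda>a r. of_bool (r = a) * (x ^ a * y ^ (i - a))"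
  have "trace_quot (tens i) (ideal_deg (Qalg q) i) (act (mat2 x 0 0 y) i) = (\<Sum>a\<le>i. ?M a a)"
  proof (rule trace_quot_coord[where M = ?M])
    fix f and a :: nat assume "a \<le> i"
    have "coord (Qalg q) i a (act (mat2 x 0 0 y) i f) = x ^ a * y ^ (i - a) * coord (Qalg q) i a f"
      unfolding coord_act_diag unfolding coord_def sum_distrib_left
    proof (intro sum.cong refl)
      fix w assume "w \<in> words i"
      thus "f w * (x ^ count_list w False * y ^ count_list w True * nf (Qalg q) w a)
          = x ^ a * y ^ (i - a) * (f w * nf (Qalg q) w a)"
        by (cases "count_list w False = a") (auto simp: nf_Qalg_eq_0 count_list_True words_def)
    qed
    thus "coord (Qalg q) i a (act (mat2 x 0 0 y) i f) = (\<Sum>r\<le>i. ?M a r * coord (Qalg q) i r f)"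
      using \<open>a \<le> i\<close> by (simp add: of_bool_def if_distrib if_distribR cong: if_cong)
  qed
  thus ?thesis by simp
qed

text \<open>A scalar matrix acts on degree \<open>i\<close> as \<open>x ^ i\<close>, for either
  algebra. The sum is left uncollected to match the shape of \<open>trace_diag_Qalg\<close>, so that
  one power series identity serves both.\<close>

lemma trace_scalar:
  "trace_quot (tens i) (ideal_deg A i) (act (mat2 x 0 0 x) i) = (\<Sum>a\<le>i. x ^ a * x ^ (i - a))"
proof -
  let ?M = "\<lambda>a r. of_bool (r = a) * x ^ i"
  have "trace_quot (tens i) (ideal_deg A i) (act (mat2 x 0 0 x) i) = (\<Sum>a\<le>i. ?M a a)"
  proof (rule trace_quot_coord[where M = ?M])
    fix f and a :: nat assume "a \<le> i"
    have "coord A i a (act (mat2 x 0 0 x) i f) = x ^ i * coord A i a f"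
      unfolding coord_act_diag unfolding coord_def sum_distrib_left
    proof (intro sum.cong refl)
      fix w assume "w \<in> words i"
      thus "f w * (x ^ count_list w False * x ^ count_list w True * nf A w a) = x ^ i * (f w * nf A w a)"
        using count_le_length[of w False] by (auto simp: count_list_True words_def simp flip: power_add)
    qed
    thus "coord A i a (act (mat2 x 0 0 x) i f) = (\<Sum>r\<le>i. ?M a r * coord A i r f)"
      using \<open>a \<le> i\<close> by (simp add: of_bool_def if_distrib if_distribR cong: if_cong)
  qed
  thus ?thesis by (simp flip: power_add)
qed

lemma trace_antidiag:
  "trace_quot (tens i) (ideal_deg (Qalg (-1 :: 'a::comm_ring_1)) i) (act (mat2 0 b c 0) i) =
     (if even i then (- (b * c)) ^ (i div 2) else 0)"
proof -
  let ?A = "Qalg (-1 :: 'a)"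
  let ?M = "\<lambda>a r. of_bool (r = i - a) * ((-1) ^ (a * (i - a)) * (c ^ (i - a) * b ^ a))"
  have "trace_quot (tens i) (ideal_deg ?A i) (act (mat2 0 b c 0) i) = (\<Sum>a\<le>i. ?M a a)"
  proof (rule trace_quot_coord[where M = ?M])
    fix f and a :: nat assume a: "a \<le> i"
    have "coord ?A i a (act (mat2 0 b c 0) i f) =
        (-1) ^ (a * (i - a)) * (c ^ (i - a) * b ^ a) * coord ?A i (i - a) f"
      unfolding coord_act_antidiag unfolding coord_def sum_distrib_left
    proof (intro sum.cong refl)
      fix w assume "w \<in> words i"
      thus "f w * (c ^ count_list w False * b ^ count_list w True * nf ?A (map Not w) a)
          = (-1) ^ (a * (i - a)) * (c ^ (i - a) * b ^ a) * (f w * nf ?A w (i - a))"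
        using a by (cases "count_list w False = i - a")
          (auto simp: nf_Qalg_eq_0 count_list_True words_def nf_map_Not)
    qed
    thus "coord ?A i a (act (mat2 0 b c 0) i f) = (\<Sum>r\<le>i. ?M a r * coord ?A i r f)"
      using a by (simp add: of_bool_def if_distrib if_distribR cong: if_cong)
  qed
  also have "\<dots> = (if even i then (- (b * c)) ^ (i div 2) else 0)"
  proof (cases "even i")
    case True
    then obtain l where l: "i = 2 * l" by auto
    \<comment> \<open>Monomials are exchanged by \<open>a\<close> to \<open>i - a\<close>, so only
      the middle one contributes to the trace.\<close>
    have "(\<Sum>a\<le>i. ?M a a) = (\<Sum>a\<in>{l}. ?M a a)"
      by (rule sum.mono_neutral_right) (auto simp: l)
    also have "\<dots> = (-1) ^ (l * l) * (c * b) ^ l" by (simp add: l power_mult_distrib)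
    \<comment> \<open>\<open>l * l\<close> and \<open>l\<close> have the same parity.\<close>
    also have "(-1 :: 'a) ^ (l * l) = (-1) ^ l" by (cases "even l") auto
    finally show ?thesis by (simp add: l mult.commute flip: power_mult_distrib)
  next
    case False
    have "(\<Sum>a\<le>i. ?M a a) = 0"
    proof (rule sum.neutral, safe)
      fix a assume "a \<le> i"
      have "a \<noteq> i - a"
      proof
        assume "a = i - a"
        hence "i = 2 * a" using \<open>a \<le> i\<close> by simp
        thus False using False by simp
      qed
      thus "?M a a = 0" by simp
    qed
    thus ?thesis using False by simp
  qed
  finally show ?thesis .
qed

section \<open>Trace series as inverses of polynomials\<close>

lemma fps_geometric_mult: "Abs_fps (\<lambda>n. x ^ n) * fps_of_poly [:1, -x :: 'a::field:] = 1"
proof (rule fps_ext)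
  fix n
  have "Abs_fps (\<lambda>n. x ^ n) * fps_of_poly [:1, -x:] =
      Abs_fps (\<lambda>n. x ^ n) - fps_const x * (Abs_fps (\<lambda>n. x ^ n) * fps_X)"
    by (simp add: fps_of_poly_linear' algebra_simps flip: fps_const_neg)
  thus "fps_nth (Abs_fps (\<lambda>n. x ^ n) * fps_of_poly [:1, -x:]) n = fps_nth 1 n"
    by (cases n) simp_all
qed

lemma fps_two_geometric_mult:
  "Abs_fps (\<lambda>i. \<Sum>a\<le>i. x ^ a * y ^ (i - a)) * fps_of_poly ([:1, -x:] * [:1, -y :: 'a::field:]) = 1"
proof -
  have "Abs_fps (\<lambda>i. \<Sum>a\<le>i. x ^ a * y ^ (i - a)) = Abs_fps (\<lambda>n. x ^ n) * Abs_fps (\<lambda>n. y ^ n)"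
    by (rule fps_ext) (simp add: fps_mult_nth atLeast0AtMost)
  hence "Abs_fps (\<lambda>i. \<Sum>a\<le>i. x ^ a * y ^ (i - a)) * fps_of_poly ([:1, -x:] * [:1, -y:])
      = (Abs_fps (\<lambda>n. x ^ n) * fps_of_poly [:1, -x:]) * (Abs_fps (\<lambda>n. y ^ n) * fps_of_poly [:1, -y:])"
    unfolding fps_of_poly_mult by (simp only: mult_ac)
  thus ?thesis by (simp only: fps_geometric_mult mult_1)
qed

lemma fps_even_geometric_mult:
  "Abs_fps (\<lambda>i. if even i then (- e) ^ (i div 2) else 0) * fps_of_poly [:1, 0, e :: 'a::field:] = 1"
  (is "?F * _ = 1")
proof (rule fps_ext)
  fix n
  have "[:1, 0, e:] = [:1:] + smult e (monom 1 2)"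
    by (simp add: monom_altdef power2_eq_square)
  hence P: "fps_of_poly [:1, 0, e:] = 1 + fps_const e * fps_X ^ 2"
    by (simp only: fps_of_poly_add fps_of_poly_smult fps_of_poly_monom' fps_of_poly_1')
  have "?F * fps_of_poly [:1, 0, e:] = ?F + fps_const e * (?F * fps_X ^ 2)"
    unfolding P by (simp only: distrib_left mult_1_right mult.left_commute)
  hence eq: "fps_nth (?F * fps_of_poly [:1, 0, e:]) n = fps_nth ?F n + e * fps_nth (?F * fps_X ^ 2) n"
    by simp
  consider "n = 0" | "n = 1" | m where "n = Suc (Suc m)" by (metis One_nat_def nat.exhaust)
  thus "fps_nth (?F * fps_of_poly [:1, 0, e:]) n = fps_nth 1 n"
    unfolding eq by cases (simp_all add: fps_X_power_mult_right_nth)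
qed

text \<open>Cancelling the trace series shows that \<open>p\<close> must satisfy
  \<open>r = (1 - X) p\<close>. Thus a quasi-reflection means that 1 is a simple root of
  \<open>r\<close>, which the derivative detects.\<close>

lemma quasi_reflection_iff:
  assumes r: "Tr A g * fps_of_poly r = 1"
  shows "quasi_reflection A g \<longleftrightarrow> poly r 1 = 0 \<and> poly (pderiv r) 1 \<noteq> 0"
proof -
  have lin: "(1 - fps_X :: 'a fps) = fps_of_poly [:1, -1:]"
    by (simp add: fps_of_poly_linear')
  have "Tr A g \<noteq> 0" using r by auto
  have *: "Tr A g * ((1 - fps_X) * fps_of_poly p) = 1 \<longleftrightarrow> r = [:1, -1:] * p" for p
  proof -
    have "Tr A g * ((1 - fps_X) * fps_of_poly p) = Tr A g * fps_of_poly ([:1, -1:] * p)"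
      by (simp only: lin fps_of_poly_mult)
    hence "Tr A g * ((1 - fps_X) * fps_of_poly p) = 1
        \<longleftrightarrow> Tr A g * fps_of_poly ([:1, -1:] * p) = Tr A g * fps_of_poly r"
      by (simp only: r)
    also have "\<dots> \<longleftrightarrow> fps_of_poly ([:1, -1:] * p) = fps_of_poly r"
      using \<open>Tr A g \<noteq> 0\<close> by (simp only: mult_cancel_left simp_thms)
    finally show ?thesis by (auto simp: fps_of_poly_eq_iff)
  qed
  have d: "poly (pderiv ([:1, -1:] * p)) 1 = - poly p 1" for p :: "'a poly"
    by (simp only: pderiv_mult poly_add poly_mult) (simp add: pderiv_pCons)
  show ?thesis
  proof
    assume "quasi_reflection A g"
    then obtain p where p: "poly p 1 \<noteq> 0" "r = [:1, -1:] * p"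
      unfolding quasi_reflection_def * by blast
    show "poly r 1 = 0 \<and> poly (pderiv r) 1 \<noteq> 0"
      unfolding p(2) d using p(1) by simp
  next
    assume r1: "poly r 1 = 0 \<and> poly (pderiv r) 1 \<noteq> 0"
    hence "[:-1, 1:] dvd r" by (simp add: poly_eq_0_iff_dvd)
    then obtain p where "r = [:-1, 1:] * p" ..
    hence p: "r = [:1, -1:] * (- p)" by simp
    hence "poly (- p) 1 \<noteq> 0" using r1 d by (metis neg_equal_0_iff_equal)
    thus "quasi_reflection A g" unfolding quasi_reflection_def * using p by blast
  qed
qed

lemma poly_two_linear_simple_root:
  "poly ([:1, -x:] * [:1, -y:]) 1 = 0 \<and> poly (pderiv ([:1, -x:] * [:1, -y :: 'a::field:])) 1 \<noteq> 0
     \<longleftrightarrow> (x = 1) \<noteq> (y = 1)"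
  by (simp only: pderiv_mult poly_add poly_mult) (auto simp: pderiv_pCons)

lemma quasi_reflection_diag:
  "quasi_reflection (Qalg q) (mat2 x 0 0 y) \<longleftrightarrow> (x = 1) \<noteq> (y = 1)"
  unfolding poly_two_linear_simple_root[symmetric]
  by (rule quasi_reflection_iff) (simp only: Tr_def trace_diag_Qalg fps_two_geometric_mult)

text \<open>The root 1 of the denominator has multiplicity zero or two, never one.\<close>

lemma not_quasi_reflection_scalar: "\<not> quasi_reflection A (mat2 x 0 0 x)"
  by (subst quasi_reflection_iff[where r = "[:1, -x:] * [:1, -x:]"])
     (simp_all only: Tr_def trace_scalar fps_two_geometric_mult poly_two_linear_simple_root simp_thms)

text \<open>The denominator is \<open>1 + b c X^2\<close>. If it vanishes at 1, its derivative there
  is -2, nonzero in characteristic 0.\<close>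

lemma quasi_reflection_antidiag:
  "quasi_reflection (Qalg (-1)) (mat2 0 b c 0) \<longleftrightarrow> b * c = (-1 :: 'a::field_char_0)"
proof -
  have "quasi_reflection (Qalg (-1)) (mat2 0 b c 0) \<longleftrightarrow>
      poly [:1, 0, b * c:] 1 = 0 \<and> poly (pderiv [:1, 0, b * c:]) 1 \<noteq> 0"
    by (rule quasi_reflection_iff) (simp only: Tr_def trace_antidiag fps_even_geometric_mult)
  thus ?thesis by (auto simp: pderiv_pCons eq_neg_iff_add_eq_0 add.commute)
qed

section \<open>Matrices and graded automorphisms\<close>

lemma mat2_nth: 
  "mat2 a b c d $ 1 $ 1 = a" "mat2 a b c d $ 1 $ 2 = b" "mat2 a b c d $ 2 $ 1 = c" "mat2 a b c d $ 2 $ 2 = d"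
  by (simp_all add: mat2_def)

lemma mat2_eq_iff [simp]: "mat2 a b c d = mat2 a' b' c' d' \<longleftrightarrow> a = a' \<and> b = b' \<and> c = c' \<and> d = d'"
  by (auto simp: vec_eq_iff forall_2 mat2_nth)

lemma mat2_mult: "mat2 a b c d ** mat2 a' b' c' d' =
    mat2 (a * a' + b * c') (a * b' + b * d') (c * a' + d * c') (c * b' + d * d')"
  by (simp add: vec_eq_iff forall_2 matrix_matrix_mult_def sum_2 mat2_nth)

lemma mat_1_eq_mat2: "mat 1 = mat2 1 0 0 1"
  by (simp add: vec_eq_iff forall_2 mat2_nth mat_def)

lemma det_mat2: "det (mat2 a b c d) = a * d - b * c"
  by (simp add: det_2 mat2_nth)

lemma mat2_cases: obtains a b c d where "g = mat2 a b c d"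
proof
  show "g = mat2 (g $ 1 $ 1) (g $ 1 $ 2) (g $ 2 $ 1) (g $ 2 $ 2)"
    by (simp add: vec_eq_iff forall_2 mat2_nth)
qed

lemma matrix_inv_eqI:
  fixes A B :: "'a::field^2^2"
  assumes "A ** B = mat 1" "B ** A = mat 1"
  shows "matrix_inv A = B"
  unfolding matrix_inv_def
proof (rule some_equality)
  fix C assume "A ** C = mat 1 \<and> C ** A = mat 1"
  thus "C = B" using assms by (metis matrix_mul_assoc matrix_mul_lid matrix_mul_rid)
qed (use assms in auto)

lemma act_2:
  "act g 2 f [x, y] = f [True, True] * (gc g True x * gc g True y)
     + f [True, False] * (gc g True x * gc g False y)
     + f [False, True] * (gc g False x * gc g True y)
     + f [False, False] * (gc g False x * gc g False y)"
  by (simp add: act_def numeral_2_eq_2 sum_words_Suc words_0 algebra_simps)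

text \<open>Both sides vanish off words of length 2, so four coefficients decide the
  equality.\<close>

lemma act_2_rel_iff:
  "act g 2 (rel A) = (\<lambda>w. c * rel A w) \<longleftrightarrow>
    (\<forall>x y. act g 2 (rel A) [x, y] = c * rel A [x, y])"
proof
  assume *: "\<forall>x y. act g 2 (rel A) [x, y] = c * rel A [x, y]"
  show "act g 2 (rel A) = (\<lambda>w. c * rel A w)"
  proof
    fix w
    show "act g 2 (rel A) w = c * rel A w"
    proof (cases "length w = 2")
      case True
      then obtain x y where "w = [x, y]" by (auto simp: numeral_2_eq_2 length_Suc_conv)
      thus ?thesis using * by simp
    next
      case False
      hence "rel A w = 0" by (cases A) auto
      thus ?thesis using False by (simp add: act_def)
    qed
  qed
qed simp

lemma Aut_Qalg:
  fixes q :: "'a::field"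
  assumes "q \<noteq> 1"
  shows "mat2 a b c d \<in> Aut (Qalg q) \<longleftrightarrow>
    b = 0 \<and> c = 0 \<and> a \<noteq> 0 \<and> d \<noteq> 0 \<or> q = -1 \<and> a = 0 \<and> d = 0 \<and> b \<noteq> 0 \<and> c \<noteq> 0"
proof -
  have "mat2 a b c d \<in> Aut (Qalg q) \<longleftrightarrow> a * d - b * c \<noteq> 0 \<and>
     (\<exists>z. d * c - q * (c * d) = 0 \<and> d * a - q * (c * b) = z \<and> b * c - q * (a * d) = - (q * z)
        \<and> b * a - q * (a * b) = 0)"
    unfolding Aut_def is_gr_aut_def mem_Collect_eq act_2_rel_iff act_2 all_bool_eq
    by (simp add: det_mat2 gc_mat2 mult.commute algebra_simps)
  \<comment> \<open>The coefficient of \<open>vu\<close> determines the scalar \<open>z\<close>,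
    which is eliminated from the other three equations.\<close>
  also have "\<dots> \<longleftrightarrow> a * d - b * c \<noteq> 0 \<and> d * c - q * (c * d) = 0
      \<and> b * c - q * (a * d) = - (q * (d * a - q * (c * b))) \<and> b * a - q * (a * b) = 0"
    by blast
  also have "\<dots> \<longleftrightarrow> a * d - b * c \<noteq> 0 \<and> (1 - q) * (c * d) = 0 \<and> (1 - q) * (a * b) = 0
      \<and> (1 - q) * (1 + q) * (b * c) = 0"
    by (auto simp add: algebra_simps)
  also have "\<dots> \<longleftrightarrow> a * d - b * c \<noteq> 0 \<and> (c = 0 \<or> d = 0) \<and> (a = 0 \<or> b = 0) \<and> (q = -1 \<or> b = 0 \<or> c = 0)"
    using assms by (simp add: eq_neg_iff_add_eq_0 add.commute)
  also have "\<dots> \<longleftrightarrow> b = 0 \<and> c = 0 \<and> a \<noteq> 0 \<and> d \<noteq> 0 \<or> q = -1 \<and> a = 0 \<and> d = 0 \<and> b \<noteq> 0 \<and> c \<noteq> 0"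
    by auto
  finally show ?thesis .
qed

text \<open>The coefficient of \<open>vv\<close> gives \<open>c * c = 0\<close>. Comparing those of
  \<open>vu\<close> and \<open>uu\<close> then gives \<open>d * a = a * a\<close>, where
  \<open>a\<close> is nonzero by the determinant.\<close>

lemma Aut_Jalg: "mat2 a b c d \<in> Aut Jalg \<longleftrightarrow> c = 0 \<and> d = a \<and> a \<noteq> (0 :: 'a::field)"
proof -
  have "mat2 a b c d \<in> Aut Jalg \<longleftrightarrow> a * d - b * c \<noteq> 0 \<and>
     (\<exists>z. d * c - c * d - c * c = 0 \<and> d * a - c * b - c * a = z \<and> b * c - a * d - a * c = - z
        \<and> b * a - a * b - a * a = - z)"
    unfolding Aut_def is_gr_aut_def mem_Collect_eq act_2_rel_iff act_2 all_bool_eq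
    by (simp add: det_mat2 gc_mat2 mult.commute algebra_simps)
  also have "\<dots> \<longleftrightarrow> c = 0 \<and> d = a \<and> a \<noteq> 0"
    by (auto simp: algebra_simps)
  finally show ?thesis .
qed

section \<open>Subgroups and generated subgroups\<close>

lemma is_subgroupI:
  assumes "mat 1 \<in> S" "\<And>g h. g \<in> S \<Longrightarrow> h \<in> S \<Longrightarrow> g ** h \<in> S"
    and "\<And>g. g \<in> S \<Longrightarrow> \<exists>h\<in>S. g ** h = mat 1 \<and> h ** g = mat 1"
  shows "is_subgroup S"
  unfolding is_subgroup_def
proof (intro conjI ballI)
  fix g assume "g \<in> S"
  then obtain h where "h \<in> S" "g ** h = mat 1" "h ** g = mat 1" using assms(3) by blast
  thus "invertible g" "matrix_inv g \<in> S" using matrix_inv_eqI by (auto simp: invertible_def)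
qed (use assms in auto)

lemma gen_group_eqI:
  assumes "is_subgroup S" "X \<subseteq> S" "\<And>H. is_subgroup H \<Longrightarrow> X \<subseteq> H \<Longrightarrow> S \<subseteq> H"
  shows "gen_group X = S"
  using assms unfolding gen_group_def by blast

lemma is_subgroup_mult: "is_subgroup H \<Longrightarrow> g \<in> H \<Longrightarrow> h \<in> H \<Longrightarrow> g ** h \<in> H"
  by (simp add: is_subgroup_def)

lemma is_subgroup_diag_pow:
  assumes "is_subgroup H" "mat2 x 0 0 y \<in> H"
  shows "mat2 (x ^ j) 0 0 (y ^ j) \<in> H"
proof (induction j)
  case 0
  thus ?case using assms by (simp add: is_subgroup_def flip: mat_1_eq_mat2)
next
  case (Suc j)
  from is_subgroup_mult[OF assms(1,2) this] show ?case by (simp add: mat2_mult)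
qed

section \<open>Roots of unity\<close>

lemma power_gcd_eq_1:
  fixes x :: "'a::field"
  assumes "x ^ m = 1" "x ^ n = 1"
  shows "x ^ gcd m n = 1"
proof (cases "m = 0")
  case False
  from bezout_nat[OF this, of n] obtain a b where "m * a = n * b + gcd m n" by blast
  hence "x ^ (m * a) = x ^ (n * b) * x ^ gcd m n" by (simp add: power_add)
  thus ?thesis using assms by (simp add: power_mult)
qed (use assms in simp)

lemma primroot_power_eq_1_iff:
  assumes "primroot n w"
  shows "w ^ m = 1 \<longleftrightarrow> n dvd m"
proof
  assume "w ^ m = 1"
  hence "w ^ gcd n m = 1" using assms by (intro power_gcd_eq_1) (auto simp: primroot_def)
  moreover have "0 < gcd n m" "gcd n m \<le> n" using assms by (auto simp: primroot_def intro: dvd_imp_le)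
  ultimately have "gcd n m = n" using assms by (metis primroot_def le_neq_implies_less)
  thus "n dvd m" by (metis gcd_dvd2)
next
  assume "n dvd m"
  thus "w ^ m = 1" using assms by (auto simp: primroot_def power_mult elim!: dvdE)
qed

text \<open>A smaller exponent killing \<open>w\<close> may be replaced by its gcd with
  \<open>n\<close>. This is a proper divisor of \<open>n\<close>, hence divides
  \<open>n div r\<close> for some prime \<open>r\<close>.\<close>

lemma primrootI:
  assumes n: "0 < n" and w: "w ^ n = 1" and r: "\<And>r. prime r \<Longrightarrow> r dvd n \<Longrightarrow> w ^ (n div r) \<noteq> 1"
  shows "primroot n w"
  unfolding primroot_def
proof (intro conjI allI impI n w notI)
  fix m assume m: "0 < m \<and> m < n" and "w ^ m = 1"
  hence d: "w ^ gcd m n = 1" using w by (intro power_gcd_eq_1)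
  obtain e where e: "n = gcd m n * e" by (metis gcd_dvd2 dvdE)
  have "gcd m n \<le> m" using m by (intro dvd_imp_le) auto
  hence "e \<noteq> 1" using e m by (metis mult_1_right not_le)
  then obtain r where "prime r" "r dvd e" using prime_factor_nat by blast
  then obtain f where f: "e = r * f" by (elim dvdE)
  have "n = r * (gcd m n * f)" using e f by (metis mult.left_commute)
  hence "r dvd n" and "n div r = gcd m n * f"
    using \<open>prime r\<close> by (metis dvd_triv_left, metis nonzero_mult_div_cancel_left not_prime_0)
  hence "w ^ (n div r) = 1" using d by (simp add: power_mult)
  thus False using r \<open>prime r\<close> \<open>r dvd n\<close> by blast
qed

lemma exists_nth_root:
  fixes y :: "'a::field_char_0"
  assumes alg_closed: "\<forall>p :: 'a poly. 0 < degree p \<longrightarrow> (\<exists>x. poly p x = 0)" and n: "0 < n"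
  obtains x where "x ^ n = y"
proof -
  have "degree (monom 1 n + [:- y:]) = n"
    using n by (subst degree_add_eq_left) (simp_all add: degree_monom_eq)
  then obtain x where "poly (monom 1 n + [:- y:]) x = 0" using alg_closed n by metis
  thus ?thesis using that by (simp add: poly_monom)
qed

text \<open>A root of \<open>1 + X + ... + X^(p-1)\<close> is a \<open>p\<close>-th root of unity,
  and it differs from 1 because the value at 1 is \<open>p\<close>, nonzero in characteristic
  0.\<close>

lemma exists_nontrivial_prime_root:
  assumes alg_closed: "\<forall>p :: 'a::field_char_0 poly. 0 < degree p \<longrightarrow> (\<exists>x. poly p x = 0)" and p: "prime p"
  obtains x :: "'a::field_char_0" where "x ^ p = 1" "x \<noteq> 1"
proof -
  let ?f = "(\<Sum>j<p. monom 1 j) :: 'a poly"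
  \<comment> \<open>The coefficient of \<open>X\<close> serves only to show that the degree is
    positive.\<close>
  have "coeff ?f 1 = (\<Sum>j<p. of_bool (j = 1))"
    unfolding coeff_sum by (intro sum.cong) auto
  also have "\<dots> = 1" using prime_gt_1_nat[OF p] by simp
  finally have "1 \<le> degree ?f" by (intro le_degree) simp
  then obtain x where "poly ?f x = 0" using alg_closed by (metis less_le_trans zero_less_one)
  hence x: "(\<Sum>j<p. x ^ j) = 0" by (simp add: poly_sum poly_monom)
  show ?thesis
  proof
    show "x ^ p = 1" using power_diff_1_eq[of x p] x by simp
    show "x \<noteq> 1" using x p by auto
  qed
qed

text \<open>Prime factors are added one at a time. If \<open>p\<close> divides \<open>m\<close>, a
  \<open>p\<close>-th root of a primitive \<open>m\<close>-th root works; otherwise multiply that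
  root by a nontrivial \<open>p\<close>-th root of unity.\<close>

lemma exists_primroot:
  assumes alg_closed: "\<forall>p :: 'a::field_char_0 poly. 0 < degree p \<longrightarrow> (\<exists>x. poly p x = 0)"
  shows "0 < n \<Longrightarrow> \<exists>w :: 'a::field_char_0. primroot n w"
proof (induction n rule: prime_divisors_induct)
  case (unit n)
  thus ?case by (intro exI[of _ 1]) (auto simp: primroot_def)
next
  case (factor p m)
  hence m: "0 < m" and p: "prime p" by auto
  obtain z :: 'a where z: "primroot m z" using factor.IH m by blast
  have zm: "z ^ m = 1" using z by (simp add: primroot_def)
  show ?case
  proof (cases "p dvd m")
    case True
    obtain y where y: "y ^ p = z" using exists_nth_root[OF alg_closed] p prime_gt_0_nat by metis
    have "primroot (p * m) y"
    proof (rule primrootI)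
      show "0 < p * m" using m p prime_gt_0_nat by auto
      show "y ^ (p * m) = 1" by (simp add: power_mult y zm)
      fix r assume r: "prime r" "r dvd p * m"
      \<comment> \<open>As \<open>p\<close> divides \<open>m\<close>, every prime factor of
        \<open>p * m\<close> is already one of \<open>m\<close>.\<close>
      hence "r dvd m" using p True prime_dvd_mult_iff primes_dvd_imp_eq by metis
      then obtain k where k: "m = r * k" by blast
      have "0 < k" "k < m" using k m r(1) prime_gt_1_nat[OF r(1)] by auto
      moreover have "p * m div r = p * k" using k r(1) by (simp add: not_prime_0 mult.left_commute)
      ultimately show "y ^ (p * m div r) \<noteq> 1" using z by (simp add: power_mult y primroot_def)
    qed
    thus ?thesis by blast
  next
    case False
    obtain x :: 'a where x: "x ^ p = 1" "x \<noteq> 1" using exists_nontrivial_prime_root[OF alg_closed p] .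
    have cop: "coprime p m" using False p by (simp add: prime_imp_coprime)
    have "primroot (p * m) (z * x)"
    proof (rule primrootI)
      show "0 < p * m" using m p prime_gt_0_nat by auto
      have "x ^ (p * m) = 1" "z ^ (p * m) = 1" by (simp_all add: power_mult x) (metis mult.commute power_mult power_one zm)
      thus "(z * x) ^ (p * m) = 1" by (simp add: power_mult_distrib)
      fix r assume r: "prime r" "r dvd p * m"
      show "(z * x) ^ (p * m div r) \<noteq> 1"
      proof (cases "r = p")
        case True
        have "x ^ m \<noteq> 1"
        proof
          assume "x ^ m = 1"
          hence "x ^ gcd p m = 1" using x(1) by (intro power_gcd_eq_1)
          thus False using cop x(2) by simp
        qed
        thus ?thesis using True r(1) by (simp add: power_mult_distrib zm not_prime_0)
      next
        case False
        hence "r dvd m" using r p prime_dvd_mult_iff primes_dvd_imp_eq by metis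
        then obtain k where k: "m = r * k" by blast
        have km: "0 < k" "k < m" using k m r(1) prime_gt_1_nat[OF r(1)] by auto
        have "\<not> m dvd k" using km by (meson dvd_imp_le not_le)
        hence "\<not> m dvd p * k" using cop by (simp add: coprime_commute coprime_dvd_mult_right_iff)
        hence "z ^ (p * k) \<noteq> 1" using primroot_power_eq_1_iff[OF z] by blast
        moreover have "p * m div r = p * k" using k r(1) by (simp add: not_prime_0 mult.left_commute)
        ultimately show ?thesis by (simp add: power_mult_distrib power_mult x)
      qed
    qed
    thus ?thesis by blast
  qed
qed simp

lemma primroot_power:
  assumes "primroot (d * m) w"
  shows "primroot m (w ^ d)"
proof -
  have "0 < d * m" "w ^ (d * m) = 1" "\<And>j. 0 < j \<Longrightarrow> j < d * m \<Longrightarrow> w ^ j \<noteq> 1"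
    using assms by (auto simp: primroot_def)
  thus ?thesis unfolding primroot_def power_mult[symmetric] by simp
qed

text \<open>\<open>w ^ (n * k)\<close> is a square root of 1 other than 1.\<close>

lemma primroot_half_power:
  assumes nk: "0 < n" "0 < k" and w: "primroot (2 * n * k) w"
  shows "(w ^ n) ^ k = -1"
proof -
  have "w ^ (n * k) \<noteq> 1" using w nk by (simp add: primroot_def)
  moreover have "(w ^ (n * k))\<^sup>2 = w ^ (2 * n * k)" by (simp only: mult_ac flip: power_mult)
  hence "(w ^ (n * k))\<^sup>2 = 1" using w by (simp add: primroot_def)
  ultimately show ?thesis by (auto simp: power2_eq_1_iff power_mult)
qed

lemma card_roots_unity_le:
  assumes "0 < n"
  shows "finite {x :: 'a::field. x ^ n = 1}" "card {x :: 'a. x ^ n = 1} \<le> n"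
proof -
  let ?p = "monom 1 n + [:-1:] :: 'a poly"
  have deg: "degree ?p = n"
    using assms by (subst degree_add_eq_left) (simp_all add: degree_monom_eq)
  hence ne: "?p \<noteq> 0" using assms by auto
  have eq: "{x :: 'a. x ^ n = 1} = {x. poly ?p x = 0}" by (simp add: poly_monom)
  show "finite {x :: 'a. x ^ n = 1}" unfolding eq using ne by (rule poly_roots_finite)
  show "card {x :: 'a. x ^ n = 1} \<le> n"
    unfolding eq using card_poly_roots_bound[OF ne] deg by simp
qed

text \<open>The \<open>n\<close> powers are distinct and so exhaust the at most \<open>n\<close>
  roots of \<open>X^n - 1\<close>.\<close>

lemma roots_unity_eq_powers:
  fixes w :: "'a::field"
  assumes w: "primroot n w"
  shows "{x. x ^ n = 1} = (\<lambda>j. w ^ j) ` {..<n}"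
proof -
  have n: "0 < n" and w0: "w \<noteq> 0" using w by (auto simp: primroot_def power_0_left)
  have le: "i = j" if "w ^ i = w ^ j" "i \<le> j" "j < n" for i j
  proof -
    have "w ^ i * w ^ (j - i) = w ^ (i + (j - i))" by (simp only: power_add)
    hence "w ^ i * w ^ (j - i) = w ^ i * 1" using that by simp
    hence "w ^ (j - i) = 1" using w0 by simp
    hence "n dvd j - i" using primroot_power_eq_1_iff[OF w] by blast
    thus ?thesis using that by (auto dest: dvd_imp_le)
  qed
  have inj: "inj_on (\<lambda>j. w ^ j) {..<n}"
    by (intro inj_onI) (metis le lessThan_iff nle_le)
  have "(\<lambda>j. w ^ j) ` {..<n} \<subseteq> {x. x ^ n = 1}"
    using w by (auto simp: primroot_def simp flip: power_mult) (metis mult.commute power_mult power_one)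
  moreover have "card {x :: 'a. x ^ n = 1} \<le> card ((\<lambda>j. w ^ j) ` {..<n})"
    using card_roots_unity_le(2)[OF n, where ?'a = 'a] by (simp add: card_image[OF inj])
  ultimately show ?thesis using card_roots_unity_le(1)[OF n, where ?'a = 'a] by (metis card_seteq)
qed

text \<open>Multiplication by \<open>x\<close> permutes \<open>H\<close>; comparing the products of
  all elements gives \<open>x ^ card H = 1\<close>. The bound on the number of roots then turns
  inclusion into equality.\<close>

lemma finite_mult_closed_eq_roots_unity:
  fixes H :: "'a::field set"
  assumes fin: "finite H" and one: "1 \<in> H" and zero: "0 \<notin> H"
    and mult: "\<And>x y. x \<in> H \<Longrightarrow> y \<in> H \<Longrightarrow> x * y \<in> H"
  shows "0 < card H" "H = {x. x ^ card H = 1}"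
proof -
  show pos: "0 < card H" using fin one by (auto simp: card_gt_0_iff)
  have "x ^ card H = 1" if x: "x \<in> H" for x
  proof -
    have inj: "inj_on ((*) x) H" using x zero by (auto simp: inj_on_def)
    have "(*) x ` H = H" using mult x by (intro endo_inj_surj fin inj) auto
    hence "prod id H = prod id ((*) x ` H)" by simp
    also have "\<dots> = x ^ card H * prod id H"
      using inj by (simp add: prod.reindex prod.distrib)
    finally show ?thesis using fin zero by auto
  qed
  thus "H = {x. x ^ card H = 1}"
    using card_roots_unity_le[OF pos, where ?'a = 'a] by (intro card_seteq) auto
qed

section \<open>The groups in the classification\<close>

lemma is_subgroup_diag_roots_unity:
  assumes n: "0 < n"
  shows "is_subgroup {mat2 x 0 0 (x ^ a) | x :: 'a::field. x ^ n = 1}" (is "is_subgroup ?S")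
proof (rule is_subgroupI)
  show "mat 1 \<in> ?S" by (auto simp: mat_1_eq_mat2 intro!: exI[of _ 1])
next
  fix g h assume gh: "g \<in> ?S" "h \<in> ?S"
  obtain x where x: "g = mat2 x 0 0 (x ^ a)" "x ^ n = 1" using gh(1) by blast
  obtain y where y: "h = mat2 y 0 0 (y ^ a)" "y ^ n = 1" using gh(2) by blast
  show "g ** h \<in> ?S" using x y by (auto simp: mat2_mult power_mult_distrib intro!: exI[of _ "x * y"])
next
  fix g assume "g \<in> ?S"
  then obtain x where x: "g = mat2 x 0 0 (x ^ a)" "x ^ n = 1" by blast
  hence "x \<noteq> 0" using n by (auto simp: power_0_left)
  thus "\<exists>h\<in>?S. g ** h = mat 1 \<and> h ** g = mat 1" using x
    by (intro bexI[of _ "mat2 (1 / x) 0 0 ((1 / x) ^ a)"])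
       (auto simp: mat2_mult mat_1_eq_mat2 power_one_over intro!: exI[of _ "1 / x"])
qed

text \<open>In this description only \<open>n\<close> and \<open>a\<close> enter, not the choice of
  the primitive root.\<close>

lemma cyc_eq:
  assumes w: "primroot n w"
  shows "cyc w a = {mat2 x 0 0 (x ^ a) | x. x ^ n = 1}" (is "_ = ?S")
  unfolding cyc_def
proof (rule gen_group_eqI)
  show "is_subgroup ?S" using w by (intro is_subgroup_diag_roots_unity) (simp add: primroot_def)
  show "{mat2 w 0 0 (w ^ a)} \<subseteq> ?S" using w by (auto simp: primroot_def)
  fix H assume H: "is_subgroup H" "{mat2 w 0 0 (w ^ a)} \<subseteq> H"
  show "?S \<subseteq> H"
  proof
    fix g assume "g \<in> ?S"
    then obtain x where g: "g = mat2 x 0 0 (x ^ a)" and x: "x ^ n = 1" by blast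
    obtain j where j: "x = w ^ j" using x roots_unity_eq_powers[OF w] by blast
    have "mat2 (w ^ j) 0 0 ((w ^ a) ^ j) \<in> H" using H by (intro is_subgroup_diag_pow) auto
    thus "g \<in> H" by (simp add: g j mult.commute flip: power_mult)
  qed
qed

lemma finite_cyc:
  fixes w :: "'a::field"
  assumes "primroot n w"
  shows "finite (cyc w a)"
proof -
  have "cyc w a = (\<lambda>x. mat2 x 0 0 (x ^ a)) ` {x. x ^ n = 1}" unfolding cyc_eq[OF assms] by blast
  thus ?thesis using card_roots_unity_le(1)[of n, where ?'a = 'a] assms by (simp add: primroot_def)
qed

lemma is_subgroup_cyc: "primroot n w \<Longrightarrow> is_subgroup (cyc w a)"
  by (simp add: cyc_eq is_subgroup_diag_roots_unity primroot_def)

lemma roots_unity_coprime: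
  fixes x :: "'a::field"
  assumes "coprime m n" "x ^ m = 1" "x ^ n = 1"
  shows "x = 1"
  using power_gcd_eq_1[OF assms(2,3)] assms(1) by simp

lemma small_cyc_Qalg:
  fixes q :: "'a::field"
  assumes "q \<noteq> 1" "coprime a n" "primroot n w"
  shows "small (Qalg q) (cyc w a)"
  unfolding small_def
proof (intro conjI ballI subsetI)
  have n: "0 < n" using assms(3) by (simp add: primroot_def)
  fix g assume "g \<in> cyc w a"
  then obtain x where g: "g = mat2 x 0 0 (x ^ a)" and x: "x ^ n = 1"
    unfolding cyc_eq[OF assms(3)] by blast
  have "x \<noteq> 0" using x n by (auto simp: power_0_left)
  thus "g \<in> Aut (Qalg q)" using assms(1) by (simp add: g Aut_Qalg)
  show "\<not> quasi_reflection (Qalg q) g"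
    using roots_unity_coprime[OF assms(2)] x by (auto simp: g quasi_reflection_diag)
qed (use assms in \<open>auto intro: finite_cyc is_subgroup_cyc\<close>)

lemma small_cyc_Jalg:
  assumes "primroot n w"
  shows "small Jalg (cyc w 1)"
  unfolding small_def
proof (intro conjI ballI subsetI)
  have n: "0 < n" using assms by (simp add: primroot_def)
  fix g assume "g \<in> cyc w 1"
  then obtain x where g: "g = mat2 x 0 0 x" and x: "x ^ n = 1"
    unfolding cyc_eq[OF assms] by auto
  have "x \<noteq> 0" using x n by (auto simp: power_0_left)
  thus "g \<in> Aut Jalg" by (simp add: g Aut_Jalg)
  show "\<not> quasi_reflection Jalg g" by (simp add: g not_quasi_reflection_scalar)
qed (use assms in \<open>auto intro: finite_cyc is_subgroup_cyc\<close>)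

text \<open>\<open>G\<^sub>n\<^sub>,\<^sub>k\<close> is \<open>dihedral n k \<beta>\<close> for any \<open>\<beta>\<close> with \<open>\<beta>\<^sup>k = -1\<close>: only the coset of \<open>\<beta>\<close> modulo the \<open>k\<close>-th roots
  of unity matters.\<close>

definition dihedral :: "nat \<Rightarrow> nat \<Rightarrow> 'a::field \<Rightarrow> ('a^2^2) set" where
  "dihedral n k b = {mat2 (z * t) 0 0 (z / t) | z t. z ^ k = 1 \<and> t ^ n = 1}
     \<union> {mat2 0 (b * (z * t)) (b * (z / t)) 0 | z t. z ^ k = 1 \<and> t ^ n = 1}"

lemma dihedral_diagI: "z ^ k = 1 \<Longrightarrow> t ^ n = 1 \<Longrightarrow> mat2 (z * t) 0 0 (z / t) \<in> dihedral n k b"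
  by (auto simp: dihedral_def)

lemma dihedral_antidiagI:
  "z ^ k = 1 \<Longrightarrow> t ^ n = 1 \<Longrightarrow> mat2 0 (b * (z * t)) (b * (z / t)) 0 \<in> dihedral n k b"
  by (auto simp: dihedral_def)

lemma dihedral_cases:
  assumes "g \<in> dihedral n k b"
  obtains (diag) z t where "g = mat2 (z * t) 0 0 (z / t)" "z ^ k = 1" "t ^ n = 1"
  | (antidiag) z t where "g = mat2 0 (b * (z * t)) (b * (z / t)) 0" "z ^ k = 1" "t ^ n = 1"
  using assms by (auto simp: dihedral_def)

lemma root_unity_nonzero: "0 < n \<Longrightarrow> x ^ n = 1 \<Longrightarrow> x \<noteq> (0 :: 'a::field)"
  by (auto simp: power_0_left)

lemma is_subgroup_dihedral:
  fixes b :: "'a::field"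
  assumes n: "0 < n" and k: "0 < k" and b: "b ^ (2 * k) = 1"
  shows "is_subgroup (dihedral n k b)"
proof (rule is_subgroupI)
  have b0: "b \<noteq> 0" using b k root_unity_nonzero[of "2 * k" b] by simp
  have bk: "(b * b) ^ k = 1" using b by (simp add: power_mult power2_eq_square)
  show "mat 1 \<in> dihedral n k b"
    using dihedral_diagI[of 1 k 1 n b] by (simp add: mat_1_eq_mat2)
  show "g ** h \<in> dihedral n k b" if "g \<in> dihedral n k b" "h \<in> dihedral n k b" for g h
    using that(1)
  proof (cases rule: dihedral_cases)
    case g: (diag z t)
    show ?thesis using that(2)
    proof (cases rule: dihedral_cases)
      case (diag z' t')
      thus ?thesis using g dihedral_diagI[of "z * z'" k "t * t'" n b]
        by (simp add: mat2_mult power_mult_distrib mult_ac)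
    next
      case (antidiag z' t')
      thus ?thesis using g dihedral_antidiagI[of "z * z'" k "t * t'" n b]
        by (simp add: mat2_mult power_mult_distrib mult_ac)
    qed
  next
    case g: (antidiag z t)
    show ?thesis using that(2)
    proof (cases rule: dihedral_cases)
      case (diag z' t')
      thus ?thesis using g dihedral_antidiagI[of "z * z'" k "t / t'" n b]
        by (simp add: mat2_mult power_mult_distrib power_divide mult_ac)
    next
      case (antidiag z' t')
      \<comment> \<open>Two antidiagonal elements multiply to a diagonal one with scalar part
        \<open>b^2 z z'\<close>; this is where \<open>b^2\<close> has to be a \<open>k\<close>-th
        root of unity.\<close>
      thus ?thesis using g dihedral_diagI[of "(b * b) * (z * z')" k "t / t'" n b] bk
        by (simp add: mat2_mult power_mult_distrib power_divide mult_ac)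
    qed
  qed
  show "\<exists>h\<in>dihedral n k b. g ** h = mat 1 \<and> h ** g = mat 1" if "g \<in> dihedral n k b" for g
    using that
  proof (cases rule: dihedral_cases)
    case (diag z t)
    moreover have "z \<noteq> 0" "t \<noteq> 0" using diag n k root_unity_nonzero by blast+
    ultimately show ?thesis
      by (intro bexI[of _ "mat2 ((1 / z) * (1 / t)) 0 0 ((1 / z) / (1 / t))"] dihedral_diagI)
         (simp_all add: mat2_mult mat_1_eq_mat2 power_one_over)
  next
    case (antidiag z t)
    moreover have "z \<noteq> 0" "t \<noteq> 0" using antidiag n k root_unity_nonzero by blast+
    \<comment> \<open>An antidiagonal element is inverted by keeping \<open>t\<close> and replacing
      \<open>z\<close> by \<open>1 / (b^2 z)\<close>.\<close>
    moreover have "(1 / (b * b * z)) ^ k = 1" using antidiag bk by (simp add: power_mult_distrib power_divide)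
    ultimately show ?thesis using b0
      by (intro bexI[of _ "mat2 0 (b * (1 / (b * b * z) * t)) (b * ((1 / (b * b * z)) / t)) 0"] dihedral_antidiagI)
         (simp_all add: mat2_mult mat_1_eq_mat2 power_one_over)
  qed
qed

text \<open>\<open>b / c\<close> is a \<open>k\<close>-th root of unity and is absorbed into
  \<open>z\<close>.\<close>

lemma dihedral_cong:
  fixes b c :: "'a::field"
  assumes "b ^ k = c ^ k" "c \<noteq> 0"
  shows "dihedral n k b \<subseteq> dihedral n k c"
proof
  fix g assume "g \<in> dihedral n k b"
  thus "g \<in> dihedral n k c"
  proof (cases rule: dihedral_cases)
    case (diag z t)
    thus ?thesis by (simp add: dihedral_diagI)
  next
    case (antidiag z t)
    moreover have "(b / c * z) ^ k = 1" using antidiag assms by (simp add: power_mult_distrib power_divide)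
    ultimately show ?thesis using dihedral_antidiagI[of "b / c * z" k t n c] assms(2)
      by (simp add: mult.assoc)
  qed
qed

text \<open>The first generator supplies all \<open>t\<close>, since \<open>w ^ (2 * k)\<close> is a
  primitive \<open>n\<close>-th root. The square of the second is scalar with entry
  \<open>w ^ (2 * n)\<close>, a primitive \<open>k\<close>-th root, and supplies all
  \<open>z\<close>.\<close>

lemma Gnk_eq_dihedral:
  assumes n: "0 < n" and k: "0 < k" and w: "primroot (2 * n * k) w"
  shows "Gnk n k w = dihedral n k (w ^ n)"
  unfolding Gnk_def
proof (rule gen_group_eqI)
  have w1: "w ^ (2 * n * k) = 1" using w by (simp add: primroot_def)
  have wn: "primroot n (w ^ (2 * k))" and wk: "primroot k (w ^ (2 * n))"
    using w primroot_power[of "2 * k" n w] primroot_power[of "2 * n" k w] by (simp_all add: mult_ac)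
  let ?X = "{mat2 (w ^ (2 * k)) 0 0 (inverse (w ^ (2 * k))), mat2 0 (w ^ n) (w ^ n) 0}"
  show "is_subgroup (dihedral n k (w ^ n))"
    using w1 by (intro is_subgroup_dihedral n k) (simp add: mult_ac flip: power_mult)
  show "?X \<subseteq> dihedral n k (w ^ n)"
    using dihedral_diagI[of 1 k "w ^ (2 * k)" n "w ^ n"] dihedral_antidiagI[of 1 k 1 n "w ^ n"] wn
    by (auto simp: primroot_def inverse_eq_divide)
  show "dihedral n k (w ^ n) \<subseteq> H" if H: "is_subgroup H" "?X \<subseteq> H" for H
  proof -
    have s: "mat2 0 (w ^ n) (w ^ n) 0 \<in> H" using H by simp
    from is_subgroup_mult[OF H(1) this this] have "mat2 (w ^ (2 * n)) 0 0 (w ^ (2 * n)) \<in> H"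
      by (simp add: mat2_mult mult_2 power_add)
    note scal = is_subgroup_diag_pow[OF H(1) this]
    have "mat2 (w ^ (2 * k)) 0 0 (inverse (w ^ (2 * k))) \<in> H" using H by simp
    note rot = is_subgroup_diag_pow[OF H(1) this]
    have diag: "mat2 (z * t) 0 0 (z / t) \<in> H" if zt: "z ^ k = 1" "t ^ n = 1" for z t
    proof -
      obtain i where i: "z = (w ^ (2 * n)) ^ i" using zt roots_unity_eq_powers[OF wk] by blast
      obtain j where j: "t = (w ^ (2 * k)) ^ j" using zt roots_unity_eq_powers[OF wn] by blast
      from is_subgroup_mult[OF H(1) scal[of i] rot[of j]] show ?thesis
        by (simp add: i j mat2_mult power_inverse divide_inverse)
    qed
    have "mat2 0 (w ^ n * (z * t)) (w ^ n * (z / t)) 0 \<in> H" if "z ^ k = 1" "t ^ n = 1" for z t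
      using is_subgroup_mult[OF H(1) diag[OF that] s] by (simp add: mat2_mult mult_ac)
    thus ?thesis using diag by (auto elim!: dihedral_cases)
  qed
qed

text \<open>A diagonal quasi-reflection would have \<open>z = t\<close> or \<open>z = 1 / t\<close>,
  so coprime orders force \<open>z = t = 1\<close>. An antidiagonal one means
  \<open>(b z)^2 = -1\<close>; as \<open>(b z)^k = -1\<close>, \<open>k\<close> is even, hence
  divisible by 4, and then \<open>(b z)^k = 1\<close>, a contradiction.\<close>

lemma small_dihedral:
  fixes b :: "'a::field_char_0"
  assumes n: "0 < n" and k: "0 < k" and cop: "coprime n k" and k4: "k mod 4 \<noteq> 2" and b: "b ^ k = -1"
  shows "small (Qalg (-1)) (dihedral n k b)"
  unfolding small_def
proof (intro conjI ballI subsetI)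
  have "dihedral n k b \<subseteq> (\<lambda>(z, t). mat2 (z * t) 0 0 (z / t)) ` ({z. z ^ k = 1} \<times> {t. t ^ n = 1})
      \<union> (\<lambda>(z, t). mat2 0 (b * (z * t)) (b * (z / t)) 0) ` ({z. z ^ k = 1} \<times> {t. t ^ n = 1})"
    by (auto simp: dihedral_def)
  thus "finite (dihedral n k b)"
    by (rule finite_subset) (intro finite_UnI finite_imageI finite_cartesian_product card_roots_unity_le(1) n k)
  show "is_subgroup (dihedral n k b)"
    using b by (intro is_subgroup_dihedral n k) (simp add: mult.commute[of 2] power_mult)
  have b0: "b \<noteq> 0" using b k by (auto simp: power_0_left)
  fix g assume g: "g \<in> dihedral n k b"
  show "g \<in> Aut (Qalg (-1))"
    using g
  proof (cases rule: dihedral_cases)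
    case (diag z t)
    thus ?thesis using root_unity_nonzero[OF k, of z] root_unity_nonzero[OF n, of t] by (simp add: Aut_Qalg)
  next
    case (antidiag z t)
    thus ?thesis using b0 root_unity_nonzero[OF k, of z] root_unity_nonzero[OF n, of t] by (simp add: Aut_Qalg)
  qed
  show "\<not> quasi_reflection (Qalg (-1)) g"
    using g
  proof (cases rule: dihedral_cases)
    case (diag z t)
    have t0: "t \<noteq> 0" using diag root_unity_nonzero[OF n] by blast
    have "z = 1 \<and> t = 1" if "z * t = 1 \<or> z / t = 1"
    proof -
      have "z = t \<or> z = 1 / t" using that t0 by (auto simp: field_simps)
      hence "z ^ n = 1" using diag(3) by (auto simp: power_one_over)
      hence "z = 1" using roots_unity_coprime[OF cop] diag(2) by blast
      thus ?thesis using that t0 by auto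
    qed
    thus ?thesis by (auto simp: diag(1) quasi_reflection_diag)
  next
    case (antidiag z t)
    have t0: "t \<noteq> 0" using antidiag root_unity_nonzero[OF n] by blast
    show ?thesis
    proof
      assume "quasi_reflection (Qalg (-1)) g"
      hence eq: "(b * z)\<^sup>2 = -1"
        using t0 by (simp add: antidiag(1) quasi_reflection_antidiag power2_eq_square mult_ac)
      have bz: "(b * z) ^ k = -1" using b antidiag by (simp add: power_mult_distrib)
      have "(-1 :: 'a) ^ k = ((b * z)\<^sup>2) ^ k" by (simp only: eq)
      also have "\<dots> = ((b * z) ^ k)\<^sup>2" by (simp only: mult.commute flip: power_mult)
      also have "\<dots> = 1" by (simp add: bz)
      finally have "even k" by (cases "even k") auto
      then obtain l where l: "k = 2 * l" by blast
      hence "even l" using k4 by presburger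
      hence "(b * z) ^ k = 1" by (simp add: l power_mult eq)
      thus False using bz by simp
    qed
  qed
qed

section \<open>Swap-invariant groups of diagonal matrices\<close>

text \<open>\<open>D\<close> models the diagonal part of \<open>G\<close>, and
  \<open>\<gamma>\<close> the scalar \<open>s^2\<close> of an antidiagonal \<open>s\<close>. The
  assumptions \<open>inj\<close> and \<open>small\<close> exclude diagonal and antidiagonal
  quasi-reflections. The conditions on \<open>\<gamma>\<close> in the conclusion later provide a
  square root whose \<open>k\<close>-th power is -1.\<close>

lemma swap_invariant_pairs:
  fixes D :: "'a::field_char_0 \<Rightarrow> 'a \<Rightarrow> bool" and \<gamma> :: 'a
  assumes alg_closed: "\<forall>p :: 'a poly. 0 < degree p \<longrightarrow> (\<exists>x. poly p x = 0)"
    and fin: "finite {(x, y). D x y}"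
    and one: "D 1 1"
    and mult: "\<And>x y x' y'. D x y \<Longrightarrow> D x' y' \<Longrightarrow> D (x * x') (y * y')"
    and inv: "\<And>x y. D x y \<Longrightarrow> D (1 / x) (1 / y)"
    and nz: "\<And>x y. D x y \<Longrightarrow> x \<noteq> 0 \<and> y \<noteq> 0"
    and inj: "\<And>x. D 1 x \<Longrightarrow> x = 1"
    and swap: "\<And>x y. D x y \<Longrightarrow> D y x"
    and \<gamma>: "D \<gamma> \<gamma>"
    and small: "\<And>x y. D x y \<Longrightarrow> \<gamma> * (x * y) \<noteq> -1"
  shows "\<exists>n k. 0 < n \<and> 0 < k \<and> coprime n k \<and> k mod 4 \<noteq> 2 \<and> \<gamma> ^ k = 1
    \<and> (odd k \<or> \<gamma> ^ (k div 2) = -1)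
    \<and> (\<forall>x y. D x y \<longleftrightarrow> (\<exists>z t. z ^ k = 1 \<and> t ^ n = 1 \<and> x = z * t \<and> y = z / t))"
proof -
  define K where "K = {z. D z z}"
  define N where "N = {t. D t (1 / t)}"
  define \<kappa> where "\<kappa> = card K"
  define \<nu> where "\<nu> = card N"
  have divide: "D (x / x') (y / y')" if "D x y" "D x' y'" for x y x' y'
    using mult[OF that(1) inv[OF that(2)]] by simp
  have "K \<subseteq> fst ` {(x, y). D x y}" "N \<subseteq> fst ` {(x, y). D x y}"
    by (force simp: K_def N_def)+
  hence finK: "finite K" and finN: "finite N" using fin finite_surj by blast+
  have \<kappa>: "0 < \<kappa>" and K: "D z z \<longleftrightarrow> z ^ \<kappa> = 1" for z
  proof -
    have "1 \<in> K" "0 \<notin> K" "\<And>x y. x \<in> K \<Longrightarrow> y \<in> K \<Longrightarrow> x * y \<in> K"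
      using one nz mult by (auto simp: K_def)
    from finite_mult_closed_eq_roots_unity[OF finK this]
    show "0 < \<kappa>" "D z z \<longleftrightarrow> z ^ \<kappa> = 1" unfolding \<kappa>_def K_def by blast+
  qed
  have \<nu>: "0 < \<nu>" and N: "D t (1 / t) \<longleftrightarrow> t ^ \<nu> = 1" for t
  proof -
    have "1 \<in> N" "0 \<notin> N" using one nz by (auto simp: N_def)
    moreover have "x * y \<in> N" if "x \<in> N" "y \<in> N" for x y
      using mult[of x "1 / x" y "1 / y"] that by (simp add: N_def)
    ultimately show "0 < \<nu>" "D t (1 / t) \<longleftrightarrow> t ^ \<nu> = 1"
      using finite_mult_closed_eq_roots_unity[OF finN] unfolding \<nu>_def N_def by blast+
  qed
  have sqrt: "\<exists>z :: 'a. z\<^sup>2 = x" for x using exists_nth_root[OF alg_closed, of 2] by (metis pos2)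
  have prod_K: "(x * y) ^ \<kappa> = 1" if "D x y" for x y
    using mult[OF that swap[OF that]] by (simp add: K mult.commute)
  have pm1: "x = 1 \<or> x = -1" if "x\<^sup>2 = 1" for x :: 'a
    using that by (simp add: power2_eq_1_iff)
  \<comment> \<open>Any square root \<open>z\<close> of \<open>e\<close> satisfies
    \<open>z ^ \<kappa> = e ^ l = 1\<close>, so the pair \<open>(z, z)\<close> realizes
    \<open>e\<close>.\<close>
  have \<Delta>_half: "\<exists>x y. D x y \<and> x * y = e" if "\<kappa> = 2 * l" "e ^ l = 1" for e l
  proof -
    obtain z where "z\<^sup>2 = e" using sqrt by blast
    moreover from this have "D z z" using that by (simp add: K power_mult)
    ultimately show ?thesis by (auto simp: power2_eq_square)
  qed
  have neg_inv_\<gamma>: False if "D x y" "x * y = - (1 / \<gamma>)" for x y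
    using small[OF that(1)] nz[OF \<gamma>] that(2) by simp
  \<comment> \<open>otherwise \<open>\<Delta> = K\<close>, which contains \<open>-1/\<gamma>\<close>\<close>
  have prod_square: "\<exists>z. z ^ \<kappa> = 1 \<and> z\<^sup>2 = x * y" if xy: "D x y" for x y
  proof (cases "even \<kappa>")
    case False
    then obtain l where l: "\<kappa> = 2 * l + 1" by (elim oddE)
    let ?e = "x * y"
    \<comment> \<open>For odd \<open>\<kappa>\<close> squaring is invertible on the
      \<open>\<kappa>\<close>-th roots of unity, with inverse the power
      \<open>l + 1\<close>.\<close>
    have "(?e ^ (l + 1))\<^sup>2 = ?e ^ \<kappa> * ?e" by (simp add: l power2_eq_square flip: power_add) (simp add: mult_2 add_ac)
    moreover have "(?e ^ (l + 1)) ^ \<kappa> = 1"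
      using prod_K[OF xy] by (metis power_commutes mult.commute power_mult power_one)
    ultimately show ?thesis using prod_K[OF xy] by (intro exI[of _ "?e ^ (l + 1)"]) simp
  next
    case True
    then obtain l where l: "\<kappa> = 2 * l" by blast
    let ?e = "x * y"
    have pm: "e ^ l = 1 \<or> e ^ l = -1" if "e ^ \<kappa> = 1" for e :: 'a
      using that pm1[of "e ^ l"] by (simp add: l power_mult[symmetric] mult.commute)
    show ?thesis
    proof (cases "?e ^ l = 1")
      case True
      obtain z where "z\<^sup>2 = ?e" using sqrt by blast
      thus ?thesis using True by (intro exI[of _ z]) (simp add: l power_mult)
    next
      case False
      hence el: "?e ^ l = -1" using pm prod_K[OF xy] by blast
      have "(- (1 / \<gamma>)) ^ \<kappa> = 1" using \<gamma> by (simp add: K l power_minus_even power_one_over)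
      from pm[OF this] have False
      proof
        assume "(- (1 / \<gamma>)) ^ l = 1"
        from \<Delta>_half[OF l this] show False using neg_inv_\<gamma> by blast
      next
        assume "(- (1 / \<gamma>)) ^ l = -1"
        \<comment> \<open>Both \<open>- (1 / \<gamma>)\<close> and \<open>x * y\<close> have
          \<open>l\<close>-th power -1, so their quotient is a product coming from \<open>D\<close>;
          multiplying the pairs produces the forbidden value.\<close>
        hence "(- (1 / \<gamma>) / ?e) ^ l = 1" using el by (simp only: power_divide) simp
        from \<Delta>_half[OF l this] obtain x' y' where "D x' y'" "x' * y' = - (1 / \<gamma>) / ?e" by blast
        moreover have "(x' * x) * (y' * y) = (x' * y') * ?e" by (simp add: mult_ac)
        ultimately have "D (x' * x) (y' * y)" "(x' * x) * (y' * y) = - (1 / \<gamma>)"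
          using nz[OF xy] mult xy by auto
        thus False by (rule neg_inv_\<gamma>)
      qed
      thus ?thesis ..
    qed
  qed
  \<comment> \<open>Dividing \<open>(x, y)\<close> by the scalar pair \<open>(z, z)\<close> with
    \<open>z^2 = x y\<close> leaves a pair with product 1, which belongs to
    \<open>N\<close>.\<close>
  have decomp: "D x y \<longleftrightarrow> (\<exists>z t. z ^ \<kappa> = 1 \<and> t ^ \<nu> = 1 \<and> x = z * t \<and> y = z / t)" for x y
  proof
    assume xy: "D x y"
    then obtain z where z: "z ^ \<kappa> = 1" "z\<^sup>2 = x * y" using prod_square by blast
    have z0: "z \<noteq> 0" using z(1) \<kappa> root_unity_nonzero by blast
    have yz: "y / z = 1 / (x / z)" using z(2) z0 nz[OF xy] by (simp add: field_simps power2_eq_square)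
    have "D (x / z) (y / z)" using divide[OF xy] z(1) by (simp add: K)
    hence "(x / z) ^ \<nu> = 1" unfolding yz N .
    moreover have "y = z / (x / z)" using yz z0 by (simp add: field_simps)
    ultimately show "\<exists>z t. z ^ \<kappa> = 1 \<and> t ^ \<nu> = 1 \<and> x = z * t \<and> y = z / t"
      using z(1) z0 by (intro exI[of _ z] exI[of _ "x / z"]) simp
  next
    assume "\<exists>z t. z ^ \<kappa> = 1 \<and> t ^ \<nu> = 1 \<and> x = z * t \<and> y = z / t"
    then obtain z t where zt: "z ^ \<kappa> = 1" "t ^ \<nu> = 1" "x = z * t" "y = z / t" by blast
    hence "D z z" "D t (1 / t)" using K N by blast+
    from mult[OF this] show "D x y" by (simp add: zt)
  qed
  \<comment> \<open>A common root of unity \<open>w\<close> of both orders gives the quotient pair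
    \<open>(1, w^2)\<close>, which \<open>inj\<close> makes trivial.\<close>
  have gcd2: "gcd \<kappa> \<nu> dvd 2"
  proof -
    obtain w :: 'a where w: "primroot (gcd \<kappa> \<nu>) w" using exists_primroot[OF alg_closed, of "gcd \<kappa> \<nu>"] \<kappa> by auto
    hence "w ^ \<kappa> = 1" "w ^ \<nu> = 1" by (simp_all add: primroot_power_eq_1_iff)
    hence "D w w" "D w (1 / w)" by (simp_all add: K N)
    from divide[OF this] nz[OF this(1)] have "D 1 (w\<^sup>2)" by (simp add: power2_eq_square)
    hence "w\<^sup>2 = 1" by (rule inj)
    thus ?thesis using primroot_power_eq_1_iff[OF w] by blast
  qed
  \<comment> \<open>Since -1 is its own inverse, its membership in \<open>K\<close> and in
    \<open>N\<close> is the same condition.\<close>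
  have parity: "even \<kappa> \<longleftrightarrow> even \<nu>"
    using K[of "-1"] N[of "-1"] by (simp add: minus_one_power_iff split: if_splits)
  have odd_dvd_2: "d = 1" if "d dvd 2" "odd d" for d :: nat
    using that by (metis prime_nat_iff two_is_prime_nat dvd_refl)
  have \<gamma>K: "\<gamma> ^ \<kappa> = 1" using \<gamma> K by blast
  \<comment> \<open>For odd \<open>\<kappa>\<close> the orders are already coprime. For
    \<open>\<kappa>\<close> congruent to 2 modulo 4, \<open>\<kappa>\<close> is halved; for
    \<open>\<kappa>\<close> divisible by 4, \<open>\<nu>\<close> is halved, with odd result by
    \<open>gcd2\<close>.\<close>
  consider "odd \<kappa>" | l where "\<kappa> = 2 * l" "odd l" | l where "\<kappa> = 2 * l" "even l" by (metis evenE)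
  thus ?thesis
  proof cases
    case 1
    have "coprime \<nu> \<kappa>"
    proof -
      have "odd (gcd \<kappa> \<nu>)" using 1 by auto
      with gcd2 have "gcd \<kappa> \<nu> = 1" by (rule odd_dvd_2)
      thus ?thesis by (simp add: coprime_iff_gcd_eq_1 gcd.commute)
    qed
    moreover have "\<kappa> mod 4 \<noteq> 2" using 1 by presburger
    ultimately show ?thesis using \<kappa> \<nu> \<gamma>K 1 decomp by blast
  next
    case (2 l)
    have l0: "0 < l" using 2 \<kappa> by simp
    have pm: "e ^ l = 1 \<or> e ^ l = -1" if "e ^ \<kappa> = 1" for e :: 'a
      using that pm1[of "e ^ l"] by (simp add: 2 power_mult[symmetric] mult.commute)
    have "coprime \<nu> l"
    proof -
      have "gcd l \<nu> dvd gcd \<kappa> \<nu>" using 2 by (intro gcd_mono) auto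
      hence "gcd l \<nu> dvd 2" using gcd2 dvd_trans by blast
      moreover have "odd (gcd l \<nu>)" using 2 by auto
      ultimately have "gcd l \<nu> = 1" by (rule odd_dvd_2)
      thus ?thesis by (simp add: coprime_iff_gcd_eq_1 gcd.commute)
    qed
    moreover have "l mod 4 \<noteq> 2" using 2 by presburger
    \<comment> \<open>Were \<open>\<gamma> ^ l = -1\<close> with \<open>l\<close> odd,
      \<open>- (1 / \<gamma>)\<close> would be an \<open>l\<close>-th root of unity and hence a
      product from \<open>D\<close>.\<close>
    moreover have "\<gamma> ^ l = 1"
    proof (rule ccontr)
      assume "\<gamma> ^ l \<noteq> 1"
      hence "\<gamma> ^ l = -1" using pm \<gamma>K by blast
      hence "(- (1 / \<gamma>)) ^ l = 1" using 2 by (simp add: power_minus_odd power_one_over)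
      from \<Delta>_half[OF 2(1) this] show False using neg_inv_\<gamma> by blast
    qed
    moreover have "D x y \<longleftrightarrow> (\<exists>z t. z ^ l = 1 \<and> t ^ \<nu> = 1 \<and> x = z * t \<and> y = z / t)" for x y
    proof
      assume "D x y"
      then obtain z t where zt: "z ^ \<kappa> = 1" "t ^ \<nu> = 1" "x = z * t" "y = z / t" using decomp by blast
      show "\<exists>z t. z ^ l = 1 \<and> t ^ \<nu> = 1 \<and> x = z * t \<and> y = z / t"
      proof (cases "z ^ l = 1")
        case False
        \<comment> \<open>Changing the signs of both \<open>z\<close> and \<open>t\<close> keeps
          \<open>z * t\<close> and \<open>z / t\<close>; it repairs \<open>z ^ l\<close> as
          \<open>l\<close> is odd and keeps \<open>t ^ \<nu>\<close> as \<open>\<nu>\<close> is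
          even.\<close>
        hence "z ^ l = -1" using pm zt by blast
        moreover have "even \<nu>" using parity 2 by simp
        ultimately show ?thesis using zt 2
          by (intro exI[of _ "- z"] exI[of _ "- t"]) (simp add: power_minus_odd power_minus_even)
      qed (use zt in blast)
    next
      assume "\<exists>z t. z ^ l = 1 \<and> t ^ \<nu> = 1 \<and> x = z * t \<and> y = z / t"
      then obtain z t where zt: "z ^ l = 1" "t ^ \<nu> = 1" "x = z * t" "y = z / t" by blast
      moreover have "z ^ \<kappa> = 1" using zt(1) by (simp add: 2 mult.commute[of 2] power_mult)
      ultimately show "D x y" using decomp by blast
    qed
    ultimately show ?thesis using l0 \<nu> 2(2) by blast
  next
    case (3 l)
    obtain n where n: "\<nu> = 2 * n" using parity 3 by auto
    have n0: "0 < n" using n \<nu> by simp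
    have oddn: "odd n"
    proof
      assume "even n"
      hence "4 dvd \<kappa>" "4 dvd \<nu>" using 3 n by presburger+
      hence "4 dvd gcd \<kappa> \<nu>" by simp
      hence "4 dvd (2::nat)" using gcd2 dvd_trans by blast
      thus False by simp
    qed
    have pm: "e ^ n = 1 \<or> e ^ n = -1" if "e ^ \<nu> = 1" for e :: 'a
      using that pm1[of "e ^ n"] by (simp add: n power_mult[symmetric] mult.commute)
    have pml: "e ^ l = 1 \<or> e ^ l = -1" if "e ^ \<kappa> = 1" for e :: 'a
      using that pm1[of "e ^ l"] by (simp add: 3 power_mult[symmetric] mult.commute)
    have "coprime n \<kappa>"
    proof -
      have "gcd \<kappa> n dvd gcd \<kappa> \<nu>" using n by (intro gcd_mono) auto
      hence "gcd \<kappa> n dvd 2" using gcd2 dvd_trans by blast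
      moreover have "odd (gcd \<kappa> n)" using oddn by auto
      ultimately have "gcd \<kappa> n = 1" by (rule odd_dvd_2)
      thus ?thesis by (simp add: coprime_iff_gcd_eq_1 gcd.commute)
    qed
    moreover have "\<kappa> mod 4 \<noteq> 2" using 3 by presburger
    moreover have "\<gamma> ^ (\<kappa> div 2) = -1"
    proof (rule ccontr)
      assume "\<gamma> ^ (\<kappa> div 2) \<noteq> -1"
      hence "\<gamma> ^ l = 1" using pml \<gamma>K 3 by auto
      hence "(- (1 / \<gamma>)) ^ l = 1" using 3 by (simp add: power_minus_even power_one_over)
      from \<Delta>_half[OF 3(1) this] show False using neg_inv_\<gamma> by blast
    qed
    moreover have "D x y \<longleftrightarrow> (\<exists>z t. z ^ \<kappa> = 1 \<and> t ^ n = 1 \<and> x = z * t \<and> y = z / t)" for x y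
    proof
      assume "D x y"
      then obtain z t where zt: "z ^ \<kappa> = 1" "t ^ \<nu> = 1" "x = z * t" "y = z / t" using decomp by blast
      show "\<exists>z t. z ^ \<kappa> = 1 \<and> t ^ n = 1 \<and> x = z * t \<and> y = z / t"
      proof (cases "t ^ n = 1")
        case False
        hence "t ^ n = -1" using pm zt by blast
        moreover have "even \<kappa>" using 3 by simp
        ultimately show ?thesis using zt oddn
          by (intro exI[of _ "- z"] exI[of _ "- t"]) (simp add: power_minus_odd power_minus_even)
      qed (use zt in blast)
    next
      assume "\<exists>z t. z ^ \<kappa> = 1 \<and> t ^ n = 1 \<and> x = z * t \<and> y = z / t"
      then obtain z t where zt: "z ^ \<kappa> = 1" "t ^ n = 1" "x = z * t" "y = z / t" by blast
      moreover have "t ^ \<nu> = 1" using zt(2) by (simp add: n mult.commute[of 2] power_mult)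
      ultimately show "D x y" using decomp by blast
    qed
    ultimately show ?thesis using n0 \<kappa> \<gamma>K by blast
  qed
qed

section \<open>Classification\<close>

lemma matrix_inv_diag:
  "p \<noteq> 0 \<Longrightarrow> r \<noteq> 0 \<Longrightarrow> matrix_inv (mat2 p 0 0 r) = mat2 (1 / p) 0 0 (1 / r :: 'a::field)"
  by (rule matrix_inv_eqI) (simp_all add: mat2_mult mat_1_eq_mat2)

lemma matrix_inv_antidiag:
  "b \<noteq> 0 \<Longrightarrow> c \<noteq> 0 \<Longrightarrow> matrix_inv (mat2 0 b c 0) = mat2 0 (1 / c) (1 / b :: 'a::field) 0"
  by (rule matrix_inv_eqI) (simp_all add: mat2_mult mat_1_eq_mat2)

lemma conj_diag:
  "p \<noteq> 0 \<Longrightarrow> r \<noteq> 0 \<Longrightarrow>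
    mat2 p 0 0 r ** mat2 a b c d ** matrix_inv (mat2 p 0 0 r) = mat2 a (p * b / r) (r * c / p) (d :: 'a::field)"
  by (simp add: matrix_inv_diag mat2_mult)

lemma conj_antidiag:
  "p \<noteq> 0 \<Longrightarrow> r \<noteq> 0 \<Longrightarrow>
    mat2 0 p r 0 ** mat2 a b c d ** matrix_inv (mat2 0 p r 0) = mat2 d (p * c / r) (r * b / p) (a :: 'a::field)"
  by (simp add: matrix_inv_antidiag mat2_mult)

lemma conjg_mat_1: "conjg (mat 1) G = G"
proof -
  have "matrix_inv (mat 1 :: 'a^2^2) = mat 1" by (rule matrix_inv_eqI) simp_all
  thus ?thesis by (simp add: conjg_def)
qed

lemma subgroup_diag_inverse:
  fixes G :: "('a::field^2^2) set"
  assumes "is_subgroup G" "mat2 x 0 0 y \<in> G"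
  shows "x \<noteq> 0 \<and> y \<noteq> 0 \<and> mat2 (1 / x) 0 0 (1 / y) \<in> G"
proof -
  have "invertible (mat2 x 0 0 y)" and inv: "matrix_inv (mat2 x 0 0 y) \<in> G"
    using assms by (auto simp: is_subgroup_def)
  hence "x \<noteq> 0" "y \<noteq> 0" by (simp_all add: invertible_det_nz det_mat2)
  thus ?thesis using inv by (simp add: matrix_inv_diag)
qed

lemma subgroup_diag_mult:
  "is_subgroup G \<Longrightarrow> mat2 x 0 0 y \<in> G \<Longrightarrow> mat2 x' 0 0 y' \<in> G \<Longrightarrow> mat2 (x * x') 0 0 (y * y') \<in> G"
  using is_subgroup_mult[of G "mat2 x 0 0 y" "mat2 x' 0 0 y'"] by (simp add: mat2_mult)

lemma small_Qalg_diag: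
  assumes "small (Qalg q) G" "mat2 x 0 0 y \<in> G"
  shows "x = 1 \<longleftrightarrow> y = 1"
  using assms by (auto simp: small_def quasi_reflection_diag)

text \<open>By smallness an element is determined by its first entry. These entries form a finite
  multiplicative group, generated by some \<open>w\<close>, and the second entry over
  \<open>w\<close> is a power of \<open>w\<close>.\<close>

lemma small_diagonal_imp_cyc:
  fixes G :: "('a::field_char_0^2^2) set"
  assumes alg_closed: "\<forall>p :: 'a poly. 0 < degree p \<longrightarrow> (\<exists>x. poly p x = 0)"
    and small: "small (Qalg q) G" and nontriv: "G \<noteq> {mat 1}"
    and diag: "\<And>g. g \<in> G \<Longrightarrow> \<exists>x y. g = mat2 x 0 0 y"
  shows "\<exists>n a w. 1 \<le> a \<and> a < n \<and> coprime a n \<and> primroot n w \<and> G = cyc w a"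
proof -
  have fin: "finite G" and sub: "is_subgroup G" using small by (auto simp: small_def)
  have one: "mat2 1 0 0 1 \<in> G" using sub by (simp add: is_subgroup_def mat_1_eq_mat2)
  define H where "H = {x. \<exists>y. mat2 x 0 0 y \<in> G}"
  define n where "n = card H"
  have "H \<subseteq> (\<lambda>g. g $ 1 $ 1) ` G" by (force simp: H_def mat2_nth)
  hence "finite H" using fin finite_surj by blast
  moreover have "1 \<in> H" using one by (auto simp: H_def)
  moreover have "0 \<notin> H" using subgroup_diag_inverse[OF sub] by (auto simp: H_def)
  moreover have "x * y \<in> H" if "x \<in> H" "y \<in> H" for x y
    using that subgroup_diag_mult[OF sub] unfolding H_def by blast
  ultimately have n: "0 < n" and H: "H = {x. x ^ n = 1}"
    using finite_mult_closed_eq_roots_unity[of H] unfolding n_def by blast+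
  obtain w :: 'a where w: "primroot n w" using exists_primroot[OF alg_closed n] by blast
  hence "w \<in> H" by (simp add: H primroot_def)
  then obtain y where wy: "mat2 w 0 0 y \<in> G" by (auto simp: H_def)
  note pow = is_subgroup_diag_pow[OF sub wy]
  \<comment> \<open>The \<open>n\<close>-th power of the element has first entry 1, hence also
    second entry 1.\<close>
  have "y ^ n = 1" using pow[of n] small_Qalg_diag[OF small] w by (auto simp: primroot_def)
  then obtain a where a: "a < n" "y = w ^ a" using roots_unity_eq_powers[OF w] by blast
  have pow': "mat2 x 0 0 (x ^ a) \<in> G" if x: "x ^ n = 1" for x
  proof -
    obtain j where "x = w ^ j" using x roots_unity_eq_powers[OF w] by blast
    thus ?thesis using pow[of j] by (simp add: a mult.commute flip: power_mult)
  qed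
  have "y = x ^ a" if xy: "mat2 x 0 0 y \<in> G" for x y
  proof -
    have "x ^ n = 1" using xy H unfolding H_def by blast
    note p = pow'[OF this]
    from subgroup_diag_mult[OF sub xy] subgroup_diag_inverse[OF sub p]
    have "mat2 (x * (1 / x)) 0 0 (y * (1 / x ^ a)) \<in> G" and "x \<noteq> 0" by blast+
    hence "mat2 1 0 0 (y / x ^ a) \<in> G" by simp
    hence "y / x ^ a = 1" using small_Qalg_diag[OF small] by blast
    thus ?thesis using \<open>x \<noteq> 0\<close> by (simp add: field_simps)
  qed
  hence "G \<subseteq> cyc w a" using diag H unfolding cyc_eq[OF w] H_def by blast
  moreover have "cyc w a \<subseteq> G" using pow' unfolding cyc_eq[OF w] by blast
  ultimately have G: "G = cyc w a" by blast
  have "n \<noteq> 1"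
  proof
    assume "n = 1"
    hence "G = {mat 1}" unfolding G cyc_eq[OF w] by (auto simp: mat_1_eq_mat2)
    thus False using nontriv by blast
  qed
  \<comment> \<open>With \<open>d = gcd a n\<close> and \<open>n = d * e\<close>, the element over
    \<open>w ^ e\<close> has second entry 1. Smallness gives \<open>w ^ e = 1\<close>, so
    \<open>n\<close> divides \<open>e\<close> and \<open>d = 1\<close>.\<close>
  have cop: "coprime a n"
  proof -
    define d where "d = gcd a n"
    obtain e where e: "n = d * e" unfolding d_def by (metis dvdE gcd_dvd2)
    obtain f where f: "a = d * f" unfolding d_def by (metis dvdE gcd_dvd1)
    have "w ^ n = 1" using w by (simp add: primroot_def)
    have "(w ^ e) ^ n = (w ^ n) ^ e" by (simp only: mult.commute flip: power_mult)
    hence "(w ^ e) ^ n = 1" by (simp add: \<open>w ^ n = 1\<close>)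
    moreover have "(w ^ e) ^ a = (w ^ n) ^ f" by (simp add: e f mult_ac flip: power_mult)
    hence "(w ^ e) ^ a = 1" by (simp add: \<open>w ^ n = 1\<close>)
    ultimately have "mat2 (w ^ e) 0 0 1 \<in> G" using pow'[of "w ^ e"] by simp
    hence "w ^ e = 1" using small_Qalg_diag[OF small] by blast
    hence "n dvd e" using primroot_power_eq_1_iff[OF w] by blast
    hence "d = 1" using e n by (auto elim!: dvdE)
    thus ?thesis by (simp add: d_def coprime_iff_gcd_eq_1)
  qed
  have "1 \<le> a" using cop \<open>n \<noteq> 1\<close> by (cases a) auto
  thus ?thesis using a(1) cop w G by blast
qed

text \<open>The antidiagonal part of \<open>G\<close> is the coset of the diagonal part
  \<open>D\<close> through \<open>s\<close>. Once \<open>swap_invariant_pairs\<close> describes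
  \<open>D\<close>, a diagonal conjugation equalizes the two entries of \<open>s\<close>.\<close>

lemma small_antidiagonal_imp_Gnk:
  fixes G :: "('a::field_char_0^2^2) set"
  assumes alg_closed: "\<forall>p :: 'a poly. 0 < degree p \<longrightarrow> (\<exists>x. poly p x = 0)"
    and small: "small (Qalg (-1)) G" and s: "mat2 0 b c 0 \<in> G"
  shows "\<exists>n k w h. 0 < n \<and> 0 < k \<and> coprime n k \<and> k mod 4 \<noteq> 2
     \<and> primroot (2 * n * k) w \<and> h \<in> Aut (Qalg (-1)) \<and> conjg h G = Gnk n k w"
proof -
  have fin: "finite G" and sub: "is_subgroup G" and aut: "G \<subseteq> Aut (Qalg (-1))"
    using small by (auto simp: small_def)
  have bc: "b \<noteq> 0" "c \<noteq> 0" using s aut Aut_Qalg[of "-1" 0 b c 0] by auto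
  have s': "mat2 0 (1 / c) (1 / b) 0 \<in> G"
    using sub s matrix_inv_antidiag[OF bc] by (auto simp: is_subgroup_def)
  define D where "D x y \<longleftrightarrow> mat2 x 0 0 y \<in> G" for x y
  note mult = is_subgroup_mult[OF sub]
  \<comment> \<open>The matrix is \<open>s\<close> times the diagonal matrix of \<open>x\<close> and
    \<open>y\<close>; the antidiagonal factor exchanges their places.\<close>
  have in_G_iff: "mat2 0 (b * y) (c * x) 0 \<in> G \<longleftrightarrow> D x y" for x y
  proof
    assume "mat2 0 (b * y) (c * x) 0 \<in> G"
    from mult[OF s' this] show "D x y" using bc by (simp add: D_def mat2_mult)
  next
    assume "D x y"
    from mult[OF s this[unfolded D_def]] show "mat2 0 (b * y) (c * x) 0 \<in> G" by (simp add: mat2_mult)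
  qed
  have "\<exists>n k. 0 < n \<and> 0 < k \<and> coprime n k \<and> k mod 4 \<noteq> 2 \<and> (b * c) ^ k = 1
    \<and> (odd k \<or> (b * c) ^ (k div 2) = -1)
    \<and> (\<forall>x y. D x y \<longleftrightarrow> (\<exists>z t. z ^ k = 1 \<and> t ^ n = 1 \<and> x = z * t \<and> y = z / t))"
  proof (rule swap_invariant_pairs[OF alg_closed])
    have "{(x, y). D x y} \<subseteq> (\<lambda>g. (g $ 1 $ 1, g $ 2 $ 2)) ` G" by (force simp: D_def mat2_nth)
    thus "finite {(x, y). D x y}" using fin finite_surj by blast
    show "D 1 1" using sub by (simp add: is_subgroup_def D_def flip: mat_1_eq_mat2)
    show "D (x * x') (y * y')" if "D x y" "D x' y'" for x y x' y'
      using that subgroup_diag_mult[OF sub] by (simp add: D_def)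
    show "D (1 / x) (1 / y)" "x \<noteq> 0 \<and> y \<noteq> 0" if "D x y" for x y
      using that subgroup_diag_inverse[OF sub] by (auto simp: D_def)
    show "x = 1" if "D 1 x" for x
      using that small_Qalg_diag[OF small] by (auto simp: D_def)
    show "D y x" if "D x y" for x y
      using mult[OF mult[OF s that[unfolded D_def]] s'] bc by (simp add: D_def mat2_mult)
    show "D (b * c) (b * c)" using mult[OF s s] by (simp add: D_def mat2_mult mult.commute)
    show "b * c * (x * y) \<noteq> -1" if "D x y" for x y
    proof -
      have "\<not> quasi_reflection (Qalg (-1)) (mat2 0 (b * y) (c * x) 0)"
        using that in_G_iff small by (simp add: small_def)
      thus ?thesis by (simp add: quasi_reflection_antidiag mult_ac)
    qed
  qed
  then obtain n k where nk: "0 < n" "0 < k" "coprime n k" "k mod 4 \<noteq> 2"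
    and \<gamma>: "(b * c) ^ k = 1" "odd k \<or> (b * c) ^ (k div 2) = -1"
    and D: "\<And>x y. D x y \<longleftrightarrow> (\<exists>z t. z ^ k = 1 \<and> t ^ n = 1 \<and> x = z * t \<and> y = z / t)"
    by metis
  obtain \<beta>0 where \<beta>0: "\<beta>0\<^sup>2 = b * c" using exists_nth_root[OF alg_closed, of 2] by (metis pos2)
  \<comment> \<open>For odd \<open>k\<close> the sign of the square root can be adjusted; for even
    \<open>k\<close> either root works, as \<open>\<beta>^k\<close> equals
    \<open>(b c)^(k div 2)\<close>.\<close>
  have "\<exists>\<beta>. \<beta>\<^sup>2 = b * c \<and> \<beta> ^ k = -1"
  proof (cases "odd k")
    case True
    have "(\<beta>0 ^ k)\<^sup>2 = (\<beta>0\<^sup>2) ^ k" by (simp only: mult.commute flip: power_mult)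
    hence "(\<beta>0 ^ k)\<^sup>2 = 1" by (simp add: \<beta>0 \<gamma>)
    hence "\<beta>0 ^ k = 1 \<or> \<beta>0 ^ k = -1" by (simp add: power2_eq_1_iff)
    thus ?thesis
    proof
      assume "\<beta>0 ^ k = 1"
      thus ?thesis using \<beta>0 True by (intro exI[of _ "- \<beta>0"]) (simp add: power_minus_odd)
    qed (use \<beta>0 in blast)
  next
    case False
    then obtain l where "k = 2 * l" by blast
    thus ?thesis using \<beta>0 \<gamma> False by (intro exI[of _ \<beta>0]) (simp add: power_mult)
  qed
  then obtain \<beta> where \<beta>: "\<beta>\<^sup>2 = b * c" "\<beta> ^ k = -1" by blast
  have \<beta>_nz: "\<beta> \<noteq> 0" using \<beta>(1) bc by auto
  obtain w :: 'a where w: "primroot (2 * n * k) w"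
    using exists_primroot[OF alg_closed, of "2 * n * k"] nk by auto
  have wk: "(w ^ n) ^ k = -1" using primroot_half_power[OF nk(1,2) w] .
  have w0: "w ^ n \<noteq> 0" using wk nk by (auto simp: power_0_left)
  \<comment> \<open>Conjugation by the diagonal matrix with entries \<open>p\<close> and 1 sends
    \<open>b\<close> to \<open>p * b\<close> and \<open>c\<close> to \<open>c / p\<close>; both
    become \<open>\<beta>\<close>.\<close>
  define p where "p = \<beta> / b"
  have p: "p \<noteq> 0" "p * b = \<beta>" "c / p = \<beta>"
    using bc \<beta>_nz \<beta>(1) by (auto simp: p_def field_simps power2_eq_square)
  define h where "h = mat2 p 0 0 1"
  have h_diag: "h ** mat2 x 0 0 y ** matrix_inv h = mat2 x 0 0 y" for x y
    using p by (simp add: h_def conj_diag)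
  have h_antidiag: "h ** mat2 0 (b * y) (c * x) 0 ** matrix_inv h = mat2 0 (\<beta> * y) (\<beta> * x) 0" for x y
  proof -
    have "p * (b * y) / 1 = \<beta> * y" "1 * (c * x) / p = \<beta> * x"
      using p(2) p(3)[symmetric] by (simp_all flip: mult.assoc)
    thus ?thesis using p(1) by (simp only: h_def conj_diag one_neq_zero not_False_eq_True)
  qed
  \<comment> \<open>Replacing \<open>t\<close> by its inverse matches the order of entries in the
    antidiagonal elements.\<close>
  have Dswap: "D x y \<longleftrightarrow> (\<exists>z t. z ^ k = 1 \<and> t ^ n = 1 \<and> x = z / t \<and> y = z * t)" for x y
  proof -
    have "(\<exists>z t. z ^ k = 1 \<and> t ^ n = 1 \<and> x = z * t \<and> y = z / t)
        \<longleftrightarrow> (\<exists>z t. z ^ k = 1 \<and> t ^ n = 1 \<and> x = z / t \<and> y = z * t)" (is "?l \<longleftrightarrow> ?r")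
    proof
      assume ?l
      then obtain z t where "z ^ k = 1" "t ^ n = 1" "x = z * t" "y = z / t" by blast
      thus ?r by (intro exI[of _ z] exI[of _ "1 / t"]) (simp add: power_one_over)
    next
      assume ?r
      then obtain z t where "z ^ k = 1" "t ^ n = 1" "x = z / t" "y = z * t" by blast
      thus ?l by (intro exI[of _ z] exI[of _ "1 / t"]) (simp add: power_one_over)
    qed
    thus ?thesis using D by simp
  qed
  have "conjg h G = dihedral n k \<beta>"
  proof (intro equalityI subsetI)
    fix m assume "m \<in> conjg h G"
    then obtain g where g: "g \<in> G" and m: "m = h ** g ** matrix_inv h" by (auto simp: conjg_def)
    obtain x u v y where g': "g = mat2 x u v y" by (rule mat2_cases)
    have "g \<in> Aut (Qalg (-1))" using g aut by blast
    hence "u = 0 \<and> v = 0 \<or> x = 0 \<and> y = 0" unfolding g' by (subst (asm) Aut_Qalg) auto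
    thus "m \<in> dihedral n k \<beta>"
    proof
      assume uv: "u = 0 \<and> v = 0"
      hence "D x y" using g by (simp add: g' D_def)
      then obtain z t where "z ^ k = 1" "t ^ n = 1" "x = z * t" "y = z / t" using D by blast
      thus ?thesis using uv dihedral_diagI[of z k t n \<beta>] by (simp add: m g' h_diag)
    next
      assume xy: "x = 0 \<and> y = 0"
      hence g'': "g = mat2 0 (b * (u / b)) (c * (v / c)) 0" using bc by (simp add: g')
      hence "D (v / c) (u / b)" using g unfolding g'' in_G_iff by blast
      then obtain z t where "z ^ k = 1" "t ^ n = 1" "v / c = z / t" "u / b = z * t" using Dswap by blast
      thus ?thesis unfolding m g'' h_antidiag using dihedral_antidiagI[of z k t n \<beta>] by simp
    qed
  next
    fix m assume "m \<in> dihedral n k \<beta>"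
    thus "m \<in> conjg h G"
    proof (cases rule: dihedral_cases)
      case (diag z t)
      hence "mat2 (z * t) 0 0 (z / t) \<in> G" using D unfolding D_def by blast
      thus ?thesis unfolding conjg_def diag(1) using h_diag by (metis imageI)
    next
      case (antidiag z t)
      hence "D (z / t) (z * t)" using Dswap by blast
      hence "mat2 0 (b * (z * t)) (c * (z / t)) 0 \<in> G"
        by (simp only: in_G_iff)
      thus ?thesis unfolding conjg_def antidiag(1) using h_antidiag by (metis imageI)
    qed
  qed
  \<comment> \<open>\<open>\<beta>\<close> and \<open>w ^ n\<close> both have \<open>k\<close>-th
    power -1, so they give the same group.\<close>
  also have "\<dots> = dihedral n k (w ^ n)"
    using dihedral_cong[of \<beta> k "w ^ n" n] dihedral_cong[of "w ^ n" k \<beta> n] \<beta> \<beta>_nz wk w0 by auto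
  also have "\<dots> = Gnk n k w" using Gnk_eq_dihedral[OF nk(1,2) w] by simp
  finally have "conjg h G = Gnk n k w" .
  moreover have "h \<in> Aut (Qalg (-1))" using p(1) by (simp add: h_def Aut_Qalg)
  ultimately show ?thesis using nk w by blast
qed

text \<open>Finiteness kills the unipotent part of every element, so \<open>G\<close> consists of
  scalars and is identified with a finite multiplicative group of the field.\<close>

lemma small_Jalg_imp_cyc:
  fixes G :: "('a::field_char_0^2^2) set"
  assumes alg_closed: "\<forall>p :: 'a poly. 0 < degree p \<longrightarrow> (\<exists>x. poly p x = 0)"
    and small: "small Jalg G" and nontriv: "G \<noteq> {mat 1}"
  shows "\<exists>n w. 2 \<le> n \<and> primroot n w \<and> G = cyc w 1"
proof -
  have fin: "finite G" and sub: "is_subgroup G" and aut: "G \<subseteq> Aut Jalg"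
    using small by (auto simp: small_def)
  have scalar: "\<exists>x. g = mat2 x 0 0 x" if g: "g \<in> G" for g
  proof -
    obtain x u v y where g': "g = mat2 x u v y" by (rule mat2_cases)
    have "g \<in> Aut Jalg" using g aut by blast
    hence xy: "v = 0" "y = x" "x \<noteq> 0" by (simp_all add: g' Aut_Jalg)
    \<comment> \<open>the powers of \<open>g\<close>; in characteristic 0 they are distinct unless \<open>u = 0\<close>\<close>
    let ?f = "\<lambda>m. mat2 (x ^ m) (of_nat m * x ^ m * u / x) 0 (x ^ m)"
    have "?f m \<in> G" for m
    proof (induction m)
      case 0
      thus ?case using sub by (simp add: is_subgroup_def flip: mat_1_eq_mat2)
    next
      case (Suc m)
      have "?f (Suc m) = ?f m ** g"
        using xy by (simp add: g' mat2_mult field_simps)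
      thus ?case using is_subgroup_mult[OF sub Suc g] by simp
    qed
    hence "finite (range ?f)" using fin by (meson finite_subset image_subsetI)
    hence "\<not> inj ?f" using finite_imageD by fastforce
    then obtain i j where ij: "?f i = ?f j" "i \<noteq> j" by (auto simp: inj_def)
    hence "x ^ i = x ^ j" "of_nat i * x ^ i * u / x = of_nat j * x ^ j * u / x"
      unfolding mat2_eq_iff by blast+
    hence "of_nat i * u = of_nat j * u" using xy(3) by simp
    hence "u = 0" using ij(2) by simp
    thus ?thesis using xy by (auto simp: g')
  qed
  define H where "H = {x. mat2 x 0 0 x \<in> G}"
  define n where "n = card H"
  have "H \<subseteq> (\<lambda>g. g $ 1 $ 1) ` G" by (force simp: H_def mat2_nth)
  hence "finite H" using fin finite_surj by blast
  moreover have "1 \<in> H" using sub by (simp add: H_def is_subgroup_def flip: mat_1_eq_mat2)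
  moreover have "0 \<notin> H" using subgroup_diag_inverse[OF sub] by (auto simp: H_def)
  moreover have "x * y \<in> H" if "x \<in> H" "y \<in> H" for x y
    using that subgroup_diag_mult[OF sub] by (auto simp: H_def)
  ultimately have n: "0 < n" and H: "H = {x. x ^ n = 1}"
    using finite_mult_closed_eq_roots_unity[of H] unfolding n_def by blast+
  obtain w :: 'a where w: "primroot n w" using exists_primroot[OF alg_closed n] by blast
  have G: "G = cyc w 1"
    using scalar H unfolding cyc_eq[OF w] H_def by auto
  have "n \<noteq> 1"
  proof
    assume "n = 1"
    hence "G = {mat 1}" unfolding G cyc_eq[OF w] by (auto simp: mat_1_eq_mat2)
    thus False using nontriv by blast
  qed
  thus ?thesis using n w G by (intro exI[of _ n] exI[of _ w]) auto
qed

text \<open>All automorphisms involved are monomial, and conjugation by them never turns an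
  antidiagonal element into a diagonal one.\<close>

lemma not_conj_cyc_and_Gnk:
  fixes G :: "('a::field_char_0^2^2) set"
  assumes h: "h \<in> Aut (Qalg (-1))" and h': "h' \<in> Aut (Qalg (-1))"
    and w: "primroot m w" and C: "conjg h G = cyc w a"
    and nk: "0 < n" "0 < k" and v: "primroot (2 * n * k) v" and C': "conjg h' G = Gnk n k v"
  shows False
proof -
  have v0: "v \<noteq> 0" using v nk by (auto simp: primroot_def power_0_left)
  have "mat2 0 (v ^ n) (v ^ n) 0 \<in> conjg h' G"
    unfolding C' Gnk_eq_dihedral[OF nk v] using dihedral_antidiagI[of 1 k 1 n "v ^ n"] by simp
  then obtain g where g: "g \<in> G" "h' ** g ** matrix_inv h' = mat2 0 (v ^ n) (v ^ n) 0"
    by (auto simp: conjg_def)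
  have "h ** g ** matrix_inv h \<in> cyc w a" using g(1) C by (auto simp: conjg_def)
  then obtain x where x: "h ** g ** matrix_inv h = mat2 x 0 0 (x ^ a)" unfolding cyc_eq[OF w] by blast
  obtain g1 g2 g3 g4 where g': "g = mat2 g1 g2 g3 g4" by (rule mat2_cases)
  have cases: "(\<exists>p r. p \<noteq> 0 \<and> r \<noteq> 0 \<and> (f = mat2 p 0 0 r \<or> f = mat2 0 p r 0))"
    if f: "f \<in> Aut (Qalg (-1 :: 'a))" for f
  proof -
    obtain f1 f2 f3 f4 where f': "f = mat2 f1 f2 f3 f4" by (rule mat2_cases)
    show ?thesis using f unfolding f' by (subst (asm) Aut_Qalg) auto
  qed
  have "g2 = 0" using cases[OF h] x by (auto simp: g' conj_diag conj_antidiag)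
  moreover have "g2 \<noteq> 0" using cases[OF h'] g(2) v0 by (auto simp: g' conj_diag conj_antidiag)
  ultimately show False by blast
qed

theorem mainTheorem1:
  fixes dummy :: "'a::field_char_0"
  assumes alg_closed: "\<forall>p :: 'a poly. 0 < degree p \<longrightarrow> (\<exists>x. poly p x = 0)"
  shows
   "(\<forall>(A :: 'a alg) G.
       (\<forall>q. A = Qalg q \<longrightarrow> q \<noteq> 0 \<and> q \<noteq> 1) \<and> small A G \<and> G \<noteq> {mat 1} \<longrightarrow>
       (let C1 = ((\<exists>q. A = Qalg q) \<and> (\<exists>n a w h. 1 \<le> a \<and> a < n \<and> coprime a n \<and> primroot n w
                     \<and> h \<in> Aut A \<and> conjg h G = cyc w a));
            C2 = (A = Qalg (-1) \<and> (\<exists>n k w h. 0 < n \<and> 0 < k \<and> coprime n k \<and> k mod 4 \<noteq> 2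
                     \<and> primroot (2*n*k) w \<and> h \<in> Aut A \<and> conjg h G = Gnk n k w));
            C3 = (A = Jalg \<and> (\<exists>n w h. 2 \<le> n \<and> primroot n w \<and> h \<in> Aut A \<and> conjg h G = cyc w 1))
        in (C1 \<or> C2 \<or> C3) \<and> \<not> (C1 \<and> C2) \<and> \<not> (C1 \<and> C3) \<and> \<not> (C2 \<and> C3)))
  \<and> (\<forall>(q::'a) n a w. q \<noteq> 0 \<and> q \<noteq> 1 \<and> 1 \<le> a \<and> a < n \<and> coprime a n \<and> primroot n w
        \<longrightarrow> small (Qalg q) (cyc w a))
  \<and> (\<forall>n k (w::'a). 0 < n \<and> 0 < k \<and> coprime n k \<and> k mod 4 \<noteq> 2 \<and> primroot (2*n*k) w
        \<longrightarrow> small (Qalg (-1)) (Gnk n k w))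
  \<and> (\<forall>n (w::'a). 2 \<le> n \<and> primroot n w \<longrightarrow> small Jalg (cyc w 1))"
proof (intro conjI allI impI, goal_cases)
  case (1 A G)
  hence q: "\<And>q. A = Qalg q \<Longrightarrow> q \<noteq> 1" and small: "small A G" and nontriv: "G \<noteq> {mat 1}" by auto
  define C1 where "C1 \<longleftrightarrow> (\<exists>q. A = Qalg q) \<and> (\<exists>n a w h. 1 \<le> a \<and> a < n \<and> coprime a n \<and> primroot n w
                     \<and> h \<in> Aut A \<and> conjg h G = cyc w a)"
  define C2 where "C2 \<longleftrightarrow> A = Qalg (-1) \<and> (\<exists>n k w h. 0 < n \<and> 0 < k \<and> coprime n k \<and> k mod 4 \<noteq> 2
                     \<and> primroot (2*n*k) w \<and> h \<in> Aut A \<and> conjg h G = Gnk n k w)"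
  define C3 where "C3 \<longleftrightarrow> A = Jalg \<and> (\<exists>n w h. 2 \<le> n \<and> primroot n w \<and> h \<in> Aut A \<and> conjg h G = cyc w 1)"
  have mat1: "mat 1 \<in> Aut A" using small by (auto simp: small_def is_subgroup_def)
  have "C1 \<or> C2 \<or> C3"
  proof (cases A)
    case (Qalg p)
    show ?thesis
    proof (cases "\<forall>g\<in>G. \<exists>x y. g = mat2 x 0 0 y")
      case True
      then obtain n a w where "1 \<le> a" "a < n" "coprime a n" "primroot n w" "G = cyc w a"
        using small_diagonal_imp_cyc[OF alg_closed small[unfolded Qalg] nontriv] by blast
      hence C1 unfolding C1_def using mat1 Qalg conjg_mat_1 by blast
      thus ?thesis ..
    next
      case False
      then obtain g where g: "g \<in> G" "\<not> (\<exists>x y. g = mat2 x 0 0 y)" by blast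
      obtain a b c d where g': "g = mat2 a b c d" by (rule mat2_cases)
      have "g \<in> Aut (Qalg p)" using g(1) small Qalg by (auto simp: small_def)
      \<comment> \<open>By \<open>Aut_Qalg\<close> a non-diagonal automorphism is antidiagonal and
        occurs only at parameter -1.\<close>
      hence "p = -1 \<and> a = 0 \<and> d = 0" using g(2) q[OF Qalg] unfolding g' by (subst (asm) Aut_Qalg) auto
      hence p: "p = -1" and "mat2 0 b c 0 \<in> G" using g(1) g' by auto
      from small_antidiagonal_imp_Gnk[OF alg_closed small[unfolded Qalg p] this(2)]
      have C2 unfolding C2_def Qalg p by simp
      thus ?thesis by blast
    qed
  next
    case Jalg
    then obtain n w where "2 \<le> n" "primroot n w" "G = cyc w 1"
      using small_Jalg_imp_cyc[OF alg_closed small[unfolded Jalg] nontriv] by blast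
    hence C3 unfolding C3_def using mat1 Jalg conjg_mat_1 by blast
    thus ?thesis by blast
  qed
  \<comment> \<open>Only the first two cases can share an algebra; the third is separated from them
    by the algebra alone.\<close>
  moreover have "\<not> (C1 \<and> C2)" unfolding C1_def C2_def using not_conj_cyc_and_Gnk by blast
  moreover have "\<not> (C1 \<and> C3)" "\<not> (C2 \<and> C3)" unfolding C1_def C2_def C3_def by auto
  ultimately show ?case unfolding C1_def C2_def C3_def Let_def by blast
next
  case (2 q n a w)
  thus ?case by (auto intro: small_cyc_Qalg)
next
  case (3 n k w)
  hence nk: "0 < n" "0 < k" "coprime n k" "k mod 4 \<noteq> 2" and w: "primroot (2 * n * k) w" by auto
  show ?case
    using small_dihedral[OF nk primroot_half_power[OF nk(1,2) w]] Gnk_eq_dihedral[OF nk(1,2) w] by simp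
next
  case (4 n w)
  thus ?case using small_cyc_Jalg by blast
qed

end
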